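(* Let $m\ge 2$ and consider the billiard on the torus $\mathbb{T}^m=\mathbb{R}^m/\mathbb{Z}^m$ with one small obstacle $O$. Assume that $O$ is contained in a closed ball of radius $r<\sqrt{2}/4$, with $r$ so small that $N(r)$ is defined. Then the admissible rotation set $AR$ contains the closed ball of radius $$\frac{N(r)-1}{N(r)+1}\,\cos(2\eta(r))$$ centered at $\mathbf{0}$.
   Context: Quantities: $\eta(r)=\sum_{n=0}^\infty\arcsin\frac{r}{2^{n-1}}$. For an integer $N>1$, $\beta(N)>0$ is the smallest positive angle between two vectors of $\mathbb{Z}^{2N^2-2}\setminus\{\mathbf{0}\}$ of norm less than $N$ (then, for every $m$, any two nonzero vectors of $\mathbb{Z}^m$ of norm less than $N$ whose angle is positive form an angle at least $\beta(N)$). $N(r)$ is the maximal integer $N>1$ such that $\eta(r)<\beta(N)/2$; it is defined if such an $N$ exists, which holds for all sufficiently small $r>0$ (note $\beta(N)\to 0$ as $N\to\infty$). Setting: the obstacle $O$ on $\mathbb{T}^m$ lifts to a family of pairwise disjoint sets $O_{\mathbf{k}}=O_{\mathbf{0}}+\mathbf{k}$, $\mathbf{k}\in\mathbb{Z}^m$, in $\mathbb{R}^m$, where $O_{\mathbf{0}}$ is compact, has nonempty interior and smooth boundary, and is strictly convex (convex, with boundary containing no straight line segment). $O$ is small if it is contained in a closed ball of radius smaller than $\sqrt{2}/4$ (the lifting is then chosen so that $O_{\mathbf{k}}$ is contained in such a ball centered at $\mathbf{k}$). Billiard trajectories move with unit speed along straight lines outside the interiors of the obstacles and reflect from obstacle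 boundaries with angle of incidence equal to angle of reflection; trajectories are lifted to $\mathbb{R}^m$, and the time along a trajectory piece equals its length. A tangency is not counted as a reflection. Admissibility: $O_{\mathbf{k}}$ is between $O_{\mathbf{i}}$ and $O_{\mathbf{j}}$ if $\mathbf{k}\ne\mathbf{i},\mathbf{j}$ and $O_{\mathbf{k}}$ intersects the convex hull of $O_{\mathbf{i}}\cup O_{\mathbf{j}}$. A (finite or infinite) sequence $(\mathbf{k}_n)_{n\ge 0}$ in $\mathbb{Z}^m$ is admissible if (1) $\mathbf{k}_0=\mathbf{0}$; (2) $\mathbf{k}_{n+1}\ne\mathbf{k}_n$ for every $n$; (3) for every $n$ there is no obstacle between $O_{\mathbf{k}_n}$ and $O_{\mathbf{k}_{n+1}}$; (4) for every $n$ the obstacle $O_{\mathbf{k}_{n+1}}$ is not between $O_{\mathbf{k}_n}$ and $O_{\mathbf{k}_{n+2}}$. A trajectory piece in $\mathbb{R}^m$ has type $(\mathbf{k}_n)_{n=0}^s$ if it starts on the boundary of $O_{\mathbf{k}_0}$, reflects consecutively from $O_{\mathbf{k}_1},\dots,O_{\mathbf{k}_{s-1}}$ and ends on the boundary of $O_{\mathbf{k}_s}$ (translating so that $\mathbf{k}_0=\mathbf{0}$). The admissible rotation set $AR$ is the set of all limits of sequences $((\mathbf{y}_n-\mathbf{x}_n)/t_n)_{n=1}^\infty$ such that there is a trajectory piece of admissible type in $\mathbb{R}^m$ from $\mathbf{x}_n$ to $\mathbf{y}_n$ of length $t_n$, and $t_n\to\infty$. *)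

theory Defs
  imports "HOL-Analysis.Analysis"
begin

text \<open>The exponent is an integer: the term for \<open>n = 0\<close> is \<open>arcsin (2 * r)\<close>.\<close>

definition eta :: "real \<Rightarrow> real" where
  "eta r = (\<Sum>n. arcsin (r / 2 powi (int n - 1)))"

text \<open>The dimension in the definition of \<open>beta\<close> depends on \<open>N\<close>, so \<open>\<int>\<^sup>d\<close> is represented there
  by the extensional functions \<open>{..<d} \<rightarrow>\<^sub>E UNIV\<close>.\<close>

definition Zd_norm :: "nat \<Rightarrow> (nat \<Rightarrow> int) \<Rightarrow> real" where
  "Zd_norm d u = L2_set (\<lambda>i. real_of_int (u i)) {..<d}"

definition Zd_angle :: "nat \<Rightarrow> (nat \<Rightarrow> int) \<Rightarrow> (nat \<Rightarrow> int) \<Rightarrow> real" where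
  "Zd_angle d u v =
     arccos ((\<Sum>i<d. real_of_int (u i) * real_of_int (v i)) / (Zd_norm d u * Zd_norm d v))"

definition short_vectors :: "nat \<Rightarrow> nat \<Rightarrow> (nat \<Rightarrow> int) set" where
  "short_vectors d N =
     {u \<in> {..<d} \<rightarrow>\<^sub>E UNIV. (\<exists>i<d. u i \<noteq> 0) \<and> Zd_norm d u < real N}"

definition beta :: "nat \<Rightarrow> real" where
  "beta N = (let d = 2 * N\<^sup>2 - 2 in
     LEAST a. a > 0 \<and> (\<exists>u \<in> short_vectors d N. \<exists>v \<in> short_vectors d N. a = Zd_angle d u v))"

definition N_defined :: "real \<Rightarrow> bool" where
  "N_defined r \<longleftrightarrow> (\<exists>N>1. eta r < beta N / 2)"

definition N_of :: "real \<Rightarrow> nat" where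
  "N_of r = (GREATEST N. N > 1 \<and> eta r < beta N / 2)"

text \<open>An obstacle on the torus is given by one of its lifts \<open>K\<close> to \<open>\<real>\<^sup>m\<close>, \<open>m = CARD('m)\<close>;
  the other lifts are the translates of \<open>K\<close> by integer vectors.\<close>

definition of_int_vec :: "int ^ 'm \<Rightarrow> real ^ 'm" where
  "of_int_vec k = (\<chi> i. real_of_int (k $ i))"

definition lift :: "(real ^ 'm) set \<Rightarrow> int ^ 'm \<Rightarrow> (real ^ 'm) set" where
  "lift K k = (\<lambda>x. x + of_int_vec k) ` K"

text \<open>\<open>Ck_on k U f\<close> is meant for open \<open>U\<close>: all iterated directional derivatives of \<open>f\<close> of order
  at most \<open>k\<close> exist and are continuous on \<open>U\<close>.\<close>

primrec Ck_on :: "nat \<Rightarrow> 'a::euclidean_space set \<Rightarrow> ('a \<Rightarrow> real) \<Rightarrow> bool" where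
  "Ck_on 0 U f \<longleftrightarrow> continuous_on U f"
| "Ck_on (Suc k) U f \<longleftrightarrow>
     (\<forall>x\<in>U. f differentiable (at x)) \<and> (\<forall>v. Ck_on k U (\<lambda>x. frechet_derivative f (at x) v))"

text \<open>The boundary is a smooth hypersurface: locally the zero set of a smooth function without
  critical points.\<close>

definition smooth_boundary :: "'a::euclidean_space set \<Rightarrow> bool" where
  "smooth_boundary K \<longleftrightarrow>
     (\<forall>p \<in> frontier K. \<exists>U f. open U \<and> p \<in> U \<and> (\<forall>k. Ck_on k U f) \<and>
        (\<forall>x\<in>U. \<exists>v. frechet_derivative f (at x) v \<noteq> 0) \<and>
        frontier K \<inter> U = {x \<in> U. f x = 0})"

definition strictly_convex :: "'a::euclidean_space set \<Rightarrow> bool" where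
  "strictly_convex K \<longleftrightarrow>
     convex K \<and> (\<forall>a b. a \<noteq> b \<longrightarrow> \<not> closed_segment a b \<subseteq> frontier K)"

definition torus_obstacle :: "(real ^ 'm) set \<Rightarrow> bool" where
  "torus_obstacle K \<longleftrightarrow>
     compact K \<and> interior K \<noteq> {} \<and> smooth_boundary K \<and> strictly_convex K \<and>
     (\<forall>i j. i \<noteq> j \<longrightarrow> lift K i \<inter> lift K j = {})"

text \<open>For a convex set with nonempty interior and smooth boundary, this is the unique outward
  unit normal vector at the boundary point \<open>p\<close>.\<close>

definition outward_unit_normal :: "'a::euclidean_space set \<Rightarrow> 'a \<Rightarrow> 'a \<Rightarrow> bool" where
  "outward_unit_normal K p n \<longleftrightarrow> p \<in> frontier K \<and> norm n = 1 \<and> (\<forall>y\<in>K. (y - p) \<bullet> n \<le> 0)"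

text \<open>Elastic reflection at \<open>p\<close> of a unit velocity \<open>u\<close> into \<open>w\<close>; the condition \<open>u \<bullet> n < 0\<close>
  excludes tangencies.\<close>

definition reflects :: "'a::euclidean_space set \<Rightarrow> 'a \<Rightarrow> 'a \<Rightarrow> 'a \<Rightarrow> bool" where
  "reflects K p u w \<longleftrightarrow>
     (\<exists>n. outward_unit_normal K p n \<and> u \<bullet> n < 0 \<and> w = u - (2 * (u \<bullet> n)) *\<^sub>R n)"

text \<open>A trajectory piece is the polygonal line with vertices \<open>p 0, \<dots>, p s\<close>: its inner vertices
  are the reflection points. Between them it may be tangent to obstacles.\<close>

definition trajectory_piece ::
  "(real ^ 'm) set \<Rightarrow> nat \<Rightarrow> (nat \<Rightarrow> int ^ 'm) \<Rightarrow> (nat \<Rightarrow> real ^ 'm) \<Rightarrow> bool" where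
  "trajectory_piece K s k p \<longleftrightarrow>
     0 < s \<and>
     (\<forall>i\<le>s. p i \<in> frontier (lift K (k i))) \<and>
     (\<forall>i<s. p i \<noteq> p (Suc i)) \<and>
     (\<forall>i<s. \<forall>j. closed_segment (p i) (p (Suc i)) \<inter> interior (lift K j) = {}) \<and>
     (\<forall>i. Suc i < s \<longrightarrow>
        reflects (lift K (k (Suc i))) (p (Suc i))
          (sgn (p (Suc i) - p i)) (sgn (p (Suc (Suc i)) - p (Suc i))))"

definition piece_length :: "nat \<Rightarrow> (nat \<Rightarrow> 'a::metric_space) \<Rightarrow> real" where
  "piece_length s p = (\<Sum>i<s. dist (p i) (p (Suc i)))"

text \<open>Types are taken up to a common integer translation.\<close>

definition piece_of_type ::
  "(real ^ 'm) set \<Rightarrow> nat \<Rightarrow> (nat \<Rightarrow> int ^ 'm) \<Rightarrow> (nat \<Rightarrow> real ^ 'm) \<Rightarrow> bool" where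
  "piece_of_type K s k p \<longleftrightarrow> (\<exists>j. trajectory_piece K s (\<lambda>i. k i + j) p)"

definition between :: "(real ^ 'm) set \<Rightarrow> int ^ 'm \<Rightarrow> int ^ 'm \<Rightarrow> int ^ 'm \<Rightarrow> bool" where
  "between K k i j \<longleftrightarrow>
     k \<noteq> i \<and> k \<noteq> j \<and> lift K k \<inter> convex hull (lift K i \<union> lift K j) \<noteq> {}"

text \<open>Only the finite sequences \<open>k 0, \<dots>, k s\<close> matter for the admissible rotation set.\<close>

definition admissible :: "(real ^ 'm) set \<Rightarrow> nat \<Rightarrow> (nat \<Rightarrow> int ^ 'm) \<Rightarrow> bool" where
  "admissible K s k \<longleftrightarrow>
     k 0 = 0 \<and>
     (\<forall>n<s. k (Suc n) \<noteq> k n) \<and>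
     (\<forall>n<s. \<not> (\<exists>l. between K l (k n) (k (Suc n)))) \<and>
     (\<forall>n. Suc n < s \<longrightarrow> \<not> between K (k (Suc n)) (k n) (k (Suc (Suc n))))"

definition admissible_rotation_set :: "(real ^ 'm) set \<Rightarrow> (real ^ 'm) set" where
  "admissible_rotation_set K =
     {w. \<exists>x y t.
        (\<forall>n::nat. \<exists>s k p. admissible K s k \<and> piece_of_type K s k p \<and>
           p 0 = x n \<and> p s = y n \<and> piece_length s p = t n) \<and>
        filterlim t at_top sequentially \<and>
        (\<lambda>n. (y n - x n) /\<^sub>R t n) \<longlonglongrightarrow> w}"

end

theory Submission
  imports Defs "HOL-Real_Asymp.Real_Asymp"
begin

text \<open>
  Three facts carry the theorem.

  A shortest polygonal line that visits the obstacles of an admissible type in the given order is a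
  trajectory piece of that type (\<open>shortest_path_is_trajectory\<close>). At an inner vertex
  the derivative of the length gives the reflection law, and admissibility excludes that the line
  passes through an obstacle. So it suffices to control minimal lengths, and these grow by at most
  \<open>norm b\<close> when a step \<open>b\<close> is appended to the type: the new vertex may be the old end translated
  by \<open>b\<close>.

  Every direction is close to a long step with no obstacle in between
  (\<open>long_isolated_vector\<close>). Take a shortest nonzero integer vector in the tube of radius
  \<open>4 * r\<close> around the line of the direction \<open>e\<close>. An obstacle between its ends
  would give an integer vector at most about half as long in the same tube, because of
  \<open>2 * r + 4 * r / 2 \<le> 4 * r\<close>; so there is none. If this vector \<open>u\<close> has norm less
  than \<open>N\<close>, the hypothesis \<open>eta r < beta N / 2\<close> enters: it keeps every
  integer vector that is not parallel to \<open>u\<close> away from the line of \<open>u\<close>. A vector \<open>w\<close> in the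
  nearest coset of that line, far out along \<open>u\<close> but not so far that \<open>u\<close> is seen between its ends,
  has no obstacle in between, norm at least \<open>N\<close>, and almost the direction of \<open>u\<close>.

  Long steps cannot be repeated, because the middle obstacle would be between the others. Hence
  each long step is preceded and followed by the same signed unit vector of \<open>\<int>\<^sup>m\<close>, which is far
  from parallel to it and does not point away from \<open>e\<close>. For a block
  of length at most \<open>norm v + 2\<close> the displacement along \<open>e\<close> is at least \<open>(N - 1) / (N + 1)\<close> times
  that length. A target velocity \<open>w\<close> with \<open>norm w \<le> (N - 1) / (N + 1)\<close> is then
  tracked by feedback (\<open>reaches_tracking\<close>): if the minimal length so far is \<open>L\<close> and the
  displacement is \<open>x\<close>, choose \<open>e\<close> in the direction of the error \<open>L w - x\<close>.
  The next block changes the error by a bounded vector whose inner product with the error is not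
  positive, so after \<open>n\<close> blocks the error is of order \<open>sqrt n\<close>, while \<open>L\<close> grows at least linearly.

  In particular the ball of radius \<open>(N - 1) / (N + 1)\<close> is reached, which contains the
  ball of the theorem because the cosine is at most \<open>1\<close>.
\<close>

section \<open>Gram determinants and orthogonal components\<close>

text \<open>The squared area of the parallelogram spanned by \<open>x\<close> and \<open>y\<close>. It replaces angles below: for
  integer vectors it is an integer, and it does not change when a multiple of one vector is added to
  the other.\<close>

definition gram :: "'a::real_inner \<Rightarrow> 'a \<Rightarrow> real" where
  "gram x y = (x \<bullet> x) * (y \<bullet> y) - (x \<bullet> y)\<^sup>2"

lemma norm_sq_convex_split:
  fixes w q :: "'a::real_inner"
  shows "(1 - t) * (norm (t *\<^sub>R w + q))\<^sup>2 + t * (norm (w - (t *\<^sub>R w + q)))\<^sup>2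
       = t * (1 - t) * (norm w)\<^sup>2 + (norm q)\<^sup>2"
  unfolding power2_norm_eq_inner
  by (simp add: inner_add_left inner_add_right inner_diff_left inner_diff_right
      inner_commute[of q w]) algebra

text \<open>A point near the segment from \<open>0\<close> to \<open>w\<close> cannot be far from both ends: the mean of the
  two squared distances, weighted by \<open>1 - t\<close> and \<open>t\<close>, has no term linear in \<open>q\<close>.\<close>

lemma convex_split_bound:
  fixes w q :: "'a::real_inner"
  assumes "0 \<le> t" "t \<le> 1" "h \<le> (norm (t *\<^sub>R w + q))\<^sup>2" "h \<le> (norm (w - (t *\<^sub>R w + q)))\<^sup>2"
  shows "h \<le> (norm w)\<^sup>2 / 4 + (norm q)\<^sup>2"
proof -
  have "h = (1 - t) * h + t * h" by algebra
  also have "\<dots> \<le> t * (1 - t) * (norm w)\<^sup>2 + (norm q)\<^sup>2"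
    unfolding norm_sq_convex_split[symmetric] using assms by (intro add_mono mult_left_mono) auto
  also have "t * (1 - t) * (norm w)\<^sup>2 \<le> (1/4) * (norm w)\<^sup>2"
  proof (rule mult_right_mono)
    have "0 \<le> (t - 1/2)\<^sup>2" by simp
    then show "t * (1 - t) \<le> 1/4" by (simp add: power2_eq_square algebra_simps)
  qed simp
  finally show ?thesis by simp
qed

definition perp :: "'a::real_inner \<Rightarrow> 'a \<Rightarrow> 'a" where
  "perp u x = x - ((x \<bullet> u) / (u \<bullet> u)) *\<^sub>R u"

lemma perp_simps:
  "perp u (x + y) = perp u x + perp u y" "perp u (x - y) = perp u x - perp u y"
  "perp u (t *\<^sub>R x) = t *\<^sub>R perp u x" "perp u (- x) = - perp u x"
  by (simp_all add: perp_def inner_add_left inner_diff_left scaleR_add_left scaleR_diff_left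
      scaleR_diff_right add_divide_distrib diff_divide_distrib)

lemma perp_self [simp]: "perp u u = 0"
  by (cases "u = 0") (auto simp: perp_def)

lemma inner_perp [simp]: "perp u x \<bullet> u = 0"
  by (cases "u = 0") (auto simp: perp_def inner_diff_left)

lemma norm_sq_perp: "(norm x)\<^sup>2 = ((x \<bullet> u) / (u \<bullet> u))\<^sup>2 * (u \<bullet> u) + (norm (perp u x))\<^sup>2"
proof -
  define t where "t = (x \<bullet> u) / (u \<bullet> u)"
  define p where "p = perp u x"
  have x: "x = t *\<^sub>R u + p" by (simp add: perp_def t_def p_def)
  have "p \<bullet> u = 0" by (simp add: p_def)
  then have "x \<bullet> x = t\<^sup>2 * (u \<bullet> u) + p \<bullet> p"
    unfolding x by (simp add: inner_add_left inner_add_right inner_commute[of u p] power2_eq_square)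
  then show ?thesis by (simp add: power2_norm_eq_inner t_def p_def)
qed

lemma norm_perp_le: "norm (perp u x) \<le> norm x"
  by (rule power2_le_imp_le) (simp_all add: norm_sq_perp[of x u])

lemma gram_perp: "gram u x = (u \<bullet> u) * (norm (perp u x))\<^sup>2"
proof (cases "u = 0")
  case False
  have "gram u x = (u \<bullet> u) * (norm x)\<^sup>2 - (x \<bullet> u)\<^sup>2"
    by (simp add: gram_def power2_norm_eq_inner inner_commute)
  also have "\<dots> = (u \<bullet> u) * (norm (perp u x))\<^sup>2"
    using False unfolding norm_sq_perp[of x u] by (simp add: field_simps power2_eq_square)
  finally show ?thesis .
qed (simp add: gram_def)

lemma gram_commute: "gram x y = gram y x"
  by (simp add: gram_def inner_commute mult.commute)

lemma gram_nonneg: "0 \<le> gram x y"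
  by (simp add: gram_perp)

lemma gram_add_multiple: "gram u (x + t *\<^sub>R u) = gram u x"
  by (simp add: gram_perp perp_simps)

text \<open>\<open>gram x y\<close> is \<open>x \<bullet> x\<close> times the squared distance of \<open>y\<close> from the line of \<open>x\<close>, and
  \<open>norm q\<close> bounds that distance for \<open>y = t *\<^sub>R x + q\<close>.\<close>

lemma gram_le_dist:
  "gram x (t *\<^sub>R x + q) \<le> (x \<bullet> x) * (norm q)\<^sup>2"
proof -
  have "perp x (t *\<^sub>R x + q) = perp x q" by (simp add: perp_simps)
  then show ?thesis unfolding gram_perp using norm_perp_le[of x q]
    by (auto intro!: mult_left_mono power_mono)
qed

lemma gram_scale: "gram (t *\<^sub>R x) y = t\<^sup>2 * gram x y"
  by (simp add: gram_def power2_eq_square algebra_simps)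

section \<open>The angle condition\<close>

lemma arcsin_bounds:
  assumes "0 \<le> y" "y\<^sup>2 \<le> 1 / 2"
  shows "y \<le> arcsin y" "arcsin y \<le> 2 * y"
proof -
  have y1: "y < 1" using assms by (intro power2_less_imp_less[of y 1]) auto
  have "sin (arcsin y) \<le> arcsin y" using arcsin_nonneg[of y] assms y1 by (intro sin_x_le_x) auto
  then show "y \<le> arcsin y" using assms y1 by simp
  have s: "1 / 2 \<le> sqrt (1 - y\<^sup>2)" using assms by (intro real_le_rsqrt) (simp add: power2_eq_square)
  have "y\<^sup>2 < 1" using assms by linarith
  have "arcsin y = arctan (y / sqrt (1 - y\<^sup>2))" using assms y1 by (intro arcsin_arctan) auto
  also have "\<dots> \<le> y / sqrt (1 - y\<^sup>2)" by (intro arctan_le_self divide_nonneg_nonneg assms) (use s in linarith)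
  also have "\<dots> \<le> y / (1/2)" by (intro divide_left_mono assms s) (use \<open>y\<^sup>2 < 1\<close> in auto)
  finally show "arcsin y \<le> 2 * y" by simp
qed

text \<open>The term of index \<open>n\<close> is at least \<open>2 * r / 2 ^ n\<close>. The upper bound for \<open>arcsin\<close> is needed
  for convergence, without which \<open>eta\<close> would say nothing.\<close>

lemma eta_lower_bound:
  assumes "0 \<le> r" "r < sqrt 2 / 4"
  shows "4 * r \<le> eta r"
proof -
  define y where "y n = 2 * r * (1/2)^n" for n :: nat
  have powi: "r / 2 powi (int n - 1) = y n" for n
    by (simp add: y_def power_int_diff power_one_over)
  have "(2 * r)\<^sup>2 \<le> (sqrt 2 / 2)\<^sup>2" using assms by (intro power_mono) auto
  then have r2: "(2 * r)\<^sup>2 \<le> 1 / 2" by (simp add: power_divide)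
  have y: "0 \<le> y n" "(y n)\<^sup>2 \<le> 1/2" for n
  proof -
    show "0 \<le> y n" using assms by (simp add: y_def)
    moreover have "y n \<le> 2 * r * 1" unfolding y_def using assms by (intro mult_left_mono power_le_one) auto
    ultimately have "(y n)\<^sup>2 \<le> (2 * r)\<^sup>2" by (intro power_mono) auto
    with r2 show "(y n)\<^sup>2 \<le> 1/2" by simp
  qed
  have sy: "y sums (2 * r * 2)"
    unfolding y_def using geometric_sums[of "1/2::real"] by (intro sums_mult) simp
  have "summable (\<lambda>n. arcsin (y n))"
  proof (rule summable_comparison_test)
    show "summable (\<lambda>n. 2 * y n)" using sy sums_summable summable_mult by blast
    show "\<exists>N. \<forall>n\<ge>N. norm (arcsin (y n)) \<le> 2 * y n"
      using arcsin_bounds[OF y] order_trans[OF y(1) arcsin_bounds(1)[OF y]] by auto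
  qed
  then have "suminf y \<le> (\<Sum>n. arcsin (y n))"
    using arcsin_bounds[OF y] sums_summable[OF sy] by (intro suminf_le) auto
  then show ?thesis using sums_unique[OF sy] by (simp add: eta_def powi)
qed

lemma finite_short_vectors: "finite (short_vectors d N)"
proof (rule finite_subset)
  show "finite ({..<d} \<rightarrow>\<^sub>E {- int N..int N})" by (intro finite_PiE) auto
  show "short_vectors d N \<subseteq> {..<d} \<rightarrow>\<^sub>E {- int N..int N}"
  proof
    fix u assume u: "u \<in> short_vectors d N"
    have "u i \<in> {- int N..int N}" if "i < d" for i
    proof -
      have "\<bar>real_of_int (u i)\<bar> \<le> Zd_norm d u" 
        unfolding Zd_norm_def using that member_le_L2_set[of "{..<d}" i "\<lambda>i. \<bar>real_of_int (u i)\<bar>"]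
        by (simp add: L2_set_def)
      also have "\<dots> < real N" using u by (simp add: short_vectors_def)
      finally show ?thesis by auto
    qed
    then show "u \<in> {..<d} \<rightarrow>\<^sub>E {- int N..int N}"
      using u by (auto simp: short_vectors_def PiE_iff)
  qed
qed

text \<open>Only finitely many angles occur, so the least one exists; one positive angle is enough to
  make it meaningful.\<close>

lemma beta_le_angle:
  assumes "u \<in> short_vectors (2 * N\<^sup>2 - 2) N" "v \<in> short_vectors (2 * N\<^sup>2 - 2) N"
    and "Zd_angle (2 * N\<^sup>2 - 2) u v > 0"
  shows "beta N \<le> Zd_angle (2 * N\<^sup>2 - 2) u v" "0 < beta N"
proof -
  let ?d = "2 * N\<^sup>2 - 2"
  let ?S = "short_vectors ?d N"
  define P where "P a \<longleftrightarrow> a > 0 \<and> (\<exists>u \<in> ?S. \<exists>v \<in> ?S. a = Zd_angle ?d u v)" for a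
  have fin: "finite {a. P a}"
    by (rule finite_subset[of _ "(\<lambda>(u,v). Zd_angle ?d u v) ` (?S \<times> ?S)"])
       (auto simp: P_def finite_short_vectors)
  have P: "P (Zd_angle ?d u v)" using assms by (auto simp: P_def)
  have b: "beta N = Min {a. P a}"
    unfolding beta_def Let_def P_def[symmetric] using fin P by (intro Least_Min) auto
  show "beta N \<le> Zd_angle ?d u v" unfolding b using fin P by (intro Min_le) auto
  have "Min {a. P a} \<in> {a. P a}" using fin P by (intro Min_in) auto
  then show "0 < beta N" by (simp add: b P_def)
qed

text \<open>Two integer vectors of norm less than \<open>N\<close> have at most \<open>N\<^sup>2 - 1\<close> nonzero coordinates each.
  Renumbering the coordinates in the union of the supports moves them into dimension
  \<open>2 * N\<^sup>2 - 2\<close> with the same inner products. Hence \<open>beta\<close> serves every dimension.\<close>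

lemma Zd_vectors_of_int_vecs:
  fixes u v :: "int ^ 'm"
  assumes "u \<noteq> 0" "v \<noteq> 0" "norm (of_int_vec u) < real N" "norm (of_int_vec v) < real N"
  obtains u' v' where "u' \<in> short_vectors (2 * N\<^sup>2 - 2) N" "v' \<in> short_vectors (2 * N\<^sup>2 - 2) N"
    "Zd_angle (2 * N\<^sup>2 - 2) u' v' =
       arccos ((of_int_vec u \<bullet> of_int_vec v) / (norm (of_int_vec u) * norm (of_int_vec v)))"
proof -
  let ?d = "2 * N\<^sup>2 - 2"
  define S where "S = {i. u $ i \<noteq> 0 \<or> v $ i \<noteq> 0}"
  have norm_sq: "(norm (of_int_vec w))\<^sup>2 = real_of_int (\<Sum>i\<in>UNIV. (w $ i)\<^sup>2)" for w :: "int ^ 'm"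
    unfolding power2_norm_eq_inner inner_vec_def of_int_vec_def by (simp add: power2_eq_square)
  have card_supp: "card {i. w $ i \<noteq> 0} \<le> N\<^sup>2 - 1" if "norm (of_int_vec w) < real N" for w :: "int ^ 'm"
  proof -
    have "int (card {i. w $ i \<noteq> 0}) = (\<Sum>i\<in>{i. w $ i \<noteq> 0}. 1)" by simp
    also have "\<dots> \<le> (\<Sum>i\<in>{i. w $ i \<noteq> 0}. (w $ i)\<^sup>2)"
    proof (rule sum_mono)
      fix i assume "i \<in> {i. w $ i \<noteq> 0}"
      then have "(w $ i)\<^sup>2 \<noteq> 0" by simp
      then show "1 \<le> (w $ i)\<^sup>2" using zero_le_power2[of "w $ i"] by linarith
    qed
    also have "\<dots> \<le> (\<Sum>i\<in>UNIV. (w $ i)\<^sup>2)" by (intro sum_mono2) auto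
    finally have "real (card {i. w $ i \<noteq> 0}) \<le> (norm (of_int_vec w))\<^sup>2"
      unfolding norm_sq by (metis of_int_le_iff of_int_of_nat_eq)
    also have "\<dots> < (real N)\<^sup>2" using that by (intro power_strict_mono) auto
    finally have "card {i. w $ i \<noteq> 0} < N\<^sup>2" by (metis of_nat_less_iff of_nat_power)
    then show ?thesis by simp
  qed
  have "S = {i. u $ i \<noteq> 0} \<union> {i. v $ i \<noteq> 0}" by (auto simp: S_def)
  then have "card S \<le> card {i. u $ i \<noteq> 0} + card {i. v $ i \<noteq> 0}" by (simp add: card_Un_le)
  then have cS: "card S \<le> ?d" using card_supp[of u] card_supp[of v] assms by simp
  obtain g where g: "bij_betw g {..<card S} S"
    using ex_bij_betw_nat_finite[of S] by (auto simp: atLeast0LessThan)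
  define tr where "tr w = (\<lambda>i. if i < card S then w $ g i else if i < ?d then 0 else undefined)" 
    for w :: "int ^ 'm"
  have ip: "(\<Sum>i<?d. real_of_int (tr a i) * real_of_int (tr b i)) = of_int_vec a \<bullet> of_int_vec b"
    if "\<And>i. i \<notin> S \<Longrightarrow> a $ i = 0" for a b
  proof -
    have "(\<Sum>i<?d. real_of_int (tr a i) * real_of_int (tr b i))
        = (\<Sum>i<card S. real_of_int (tr a i) * real_of_int (tr b i))"
      by (intro sum.mono_neutral_right) (use cS in \<open>auto simp: tr_def\<close>)
    also have "\<dots> = (\<Sum>i<card S. real_of_int (a $ g i) * real_of_int (b $ g i))"
      by (intro sum.cong) (auto simp: tr_def)
    also have "\<dots> = (\<Sum>i\<in>S. real_of_int (a $ i) * real_of_int (b $ i))"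
      by (rule sum.reindex_bij_betw[OF g])
    also have "\<dots> = (\<Sum>i\<in>UNIV. real_of_int (a $ i) * real_of_int (b $ i))"
      by (intro sum.mono_neutral_left) (use that in auto)
    finally show ?thesis by (simp add: inner_vec_def of_int_vec_def)
  qed
  have uS: "\<And>i. i \<notin> S \<Longrightarrow> u $ i = 0" and vS: "\<And>i. i \<notin> S \<Longrightarrow> v $ i = 0" by (auto simp: S_def)
  have nrm: "Zd_norm ?d (tr a) = norm (of_int_vec a)" if "\<And>i. i \<notin> S \<Longrightarrow> a $ i = 0" for a
    using ip[of a a] that unfolding Zd_norm_def L2_set_def 
    by (simp add: norm_eq_sqrt_inner power2_eq_square)
  have short: "tr a \<in> short_vectors ?d N" 
    if "\<And>i. i \<notin> S \<Longrightarrow> a $ i = 0" "a \<noteq> 0" "norm (of_int_vec a) < real N" for a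
  proof -
    have "a \<noteq> 0" by (rule that(2))
    then obtain i where "a $ i \<noteq> 0" by (metis vec_eq_iff zero_index)
    with that(1) have "i \<in> S" by blast
    then obtain j where "j < card S" "g j = i" using g by (metis bij_betw_iff_bijections lessThan_iff)
    then have "tr a j \<noteq> 0" "j < ?d" using \<open>a $ i \<noteq> 0\<close> cS by (auto simp: tr_def)
    moreover have "tr a \<in> {..<?d} \<rightarrow>\<^sub>E UNIV" using cS by (auto simp: tr_def PiE_iff extensional_def)
    ultimately show ?thesis using nrm[OF that(1)] that(3) by (auto simp: short_vectors_def)
  qed
  show thesis
  proof (rule that[OF short[of u] short[of v]])
    show "Zd_angle ?d (tr u) (tr v) = arccos ((of_int_vec u \<bullet> of_int_vec v) / (norm (of_int_vec u) * norm (of_int_vec v)))"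
      unfolding Zd_angle_def by (simp add: ip[OF uS] nrm uS vS)
  qed (use assms uS vS in auto)
qed

text \<open>The bounds come from one pair of vectors: \<open>n = N\<^sup>2 - 1\<close> coordinates equal to one, and
  \<open>n - 1\<close> of these. Their angle has squared cosine \<open>1 - 1 / n\<close>.\<close>

lemma beta_small:
  assumes "N > 1"
  shows "0 < beta N" "beta N < pi / 2" "(sin (beta N))\<^sup>2 * real (N\<^sup>2 - 1) \<le> 1"
    "(beta N)\<^sup>2 \<le> 1 / 2"
proof -
  define n where "n = N\<^sup>2 - 1"
  have "2\<^sup>2 \<le> N\<^sup>2" using assms by (intro power_mono) auto
  then have n: "3 \<le> n" "2 * N\<^sup>2 - 2 = 2 * n" "real N ^ 2 = real n + 1" 
    by (auto simp: n_def of_nat_diff)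
  define ones :: "nat \<Rightarrow> nat \<Rightarrow> int" where 
    "ones j = (\<lambda>i. if i < j then 1 else if i < 2 * n then 0 else undefined)" for j
  have ip: "(\<Sum>i<2 * n. real_of_int (ones j i) * real_of_int (ones k i)) = real j"
    if "j \<le> k" "k \<le> n" for j k
  proof -
    have "(\<Sum>i<2 * n. real_of_int (ones j i) * real_of_int (ones k i)) = (\<Sum>i<j. 1)"
      using that by (intro sum.mono_neutral_cong_right) (auto simp: ones_def)
    then show ?thesis by simp
  qed
  have nrm: "Zd_norm (2 * n) (ones j) = sqrt (real j)" if "j \<le> n" for j
    using ip[of j j] that by (simp add: Zd_norm_def L2_set_def power2_eq_square)
  have short: "ones j \<in> short_vectors (2 * n) N" if "0 < j" "j \<le> n" for j
  proof -
    have "sqrt (real j) < sqrt ((real N)\<^sup>2)" using that n by (intro real_sqrt_less_mono) simp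
    then have "Zd_norm (2 * n) (ones j) < real N" using that by (simp add: nrm)
    moreover have "ones j \<in> {..<2 * n} \<rightarrow>\<^sub>E UNIV" "\<exists>i<2 * n. ones j i \<noteq> 0"
      using that by (auto simp: ones_def PiE_iff extensional_def intro!: exI[of _ 0])
    ultimately show ?thesis by (simp add: short_vectors_def)
  qed
  define c where "c = real (n - 1) / (sqrt (real (n - 1)) * sqrt (real n))"
  have ang: "Zd_angle (2 * n) (ones (n - 1)) (ones n) = arccos c"
    using ip[of "n-1" n] by (simp add: Zd_angle_def nrm c_def)
  have c2: "c\<^sup>2 = 1 - 1 / real n" "0 \<le> c"
    using n by (auto simp: c_def power_divide power_mult_distrib power2_eq_square of_nat_diff field_simps)
  have c1: "c < 1" using c2 n by (intro power2_less_imp_less[of c 1]) auto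
  have pos: "0 < arccos c" using c1 c2 arccos_lt_bounded[of c] by simp
  note b = beta_le_angle[of "ones (n-1)" N "ones n", unfolded n(2), OF short short, unfolded ang, OF _ _ _ _ pos]
  show b0: "0 < beta N" using b(2) n by simp
  have bc: "beta N \<le> arccos c" using b(1) n by simp
  have "arccos c \<le> pi" using c1 c2 by (intro arccos_ubound) auto
  then have "cos (arccos c) \<le> cos (beta N)" using b0 bc by (intro cos_monotone_0_pi_le) auto
  then have cb: "c \<le> cos (beta N)" using c1 c2 by simp
  have "2/3 \<le> c\<^sup>2" using n by (simp add: c2 field_simps)
  then have c0: "0 < c" using c2 by (cases "c = 0") auto
  have "c\<^sup>2 \<le> (cos (beta N))\<^sup>2" using cb c2 by (intro power_mono) auto
  then have s2: "(sin (beta N))\<^sup>2 \<le> 1 / real n" "(cos (beta N))\<^sup>2 \<ge> 2/3" "(sin (beta N))\<^sup>2 \<le> 1/3"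
    using c2 \<open>2/3 \<le> c\<^sup>2\<close> by (auto simp: sin_squared_eq)
  show "(sin (beta N))\<^sup>2 * real (N\<^sup>2 - 1) \<le> 1" using s2(1) n by (simp add: n_def[symmetric] field_simps)
  have "arccos c < pi / 2" using arccos_less_arccos[of 0 c] c0 c1 by simp
  then show bp: "beta N < pi / 2" using bc by simp
  have "(tan (beta N))\<^sup>2 = (sin (beta N))\<^sup>2 / (cos (beta N))\<^sup>2" by (simp add: tan_def power_divide)
  also have "\<dots> \<le> (1/3) / (2/3)" by (intro frac_le s2) auto
  finally have t2: "(tan (beta N))\<^sup>2 \<le> 1/2" by simp
  have "0 < tan (beta N)" using b0 bp by (intro tan_gt_zero) auto
  then have "arctan (tan (beta N)) \<le> tan (beta N)" by (intro arctan_le_self) auto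
  then have "beta N \<le> tan (beta N)" using b0 bp by (simp add: arctan_tan)
  then have "(beta N)\<^sup>2 \<le> (tan (beta N))\<^sup>2" using b0 by (intro power_mono) auto
  then show "(beta N)\<^sup>2 \<le> 1 / 2" using t2 by simp
qed

text \<open>Since \<open>8 * r \<le> 2 * eta r < beta N\<close>, a constant below \<open>8\<close> is left after \<open>sin\<close> is
  compared with its argument \<open>b\<close>: \<open>b\<^sup>2 \<le> 1/2\<close> makes the cubic term at most \<open>b / 12\<close>.\<close>

lemma radius_le_sin_beta:
  assumes "0 < r" "r < sqrt 2 / 4" "N > 1" "eta r < beta N / 2"
  shows "7 * r \<le> sin (beta N)"
proof -
  let ?b = "beta N"
  have b: "8 * r < ?b" using eta_lower_bound[of r] assms by simp
  have "\<bar>sin ?b - (\<Sum>m<3. sin_coeff m * ?b ^ m)\<bar> \<le> inverse (fact 3) * \<bar>?b\<bar> ^ 3"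
    by (rule Maclaurin_sin_bound)
  also have "(\<Sum>m<3. sin_coeff m * ?b ^ m) = ?b" by (simp add: numeral_3_eq_3 sin_coeff_def)
  finally have "?b - sin ?b \<le> ?b ^ 3 / 6" using beta_small(1)[OF assms(3)]
    by (simp add: fact_numeral abs_if split: if_splits)
  also have "?b ^ 3 = ?b * ?b\<^sup>2" by (simp add: power3_eq_cube power2_eq_square)
  also have "\<dots> \<le> ?b * (1/2)" using beta_small[OF assms(3)] by (intro mult_left_mono) auto
  finally show ?thesis using b assms(1) by simp
qed

lemma radius_bound:
  assumes "0 < r" "r < sqrt 2 / 4" "N > 1" "eta r < beta N / 2"
  shows "49 * r\<^sup>2 * real (N\<^sup>2 - 1) \<le> 1"
proof -
  have "(7 * r)\<^sup>2 \<le> (sin (beta N))\<^sup>2" using radius_le_sin_beta[OF assms] assms(1) by (intro power_mono) auto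
  then have "(7 * r)\<^sup>2 * real (N\<^sup>2 - 1) \<le> (sin (beta N))\<^sup>2 * real (N\<^sup>2 - 1)" by (intro mult_right_mono) auto
  with beta_small(3)[OF assms(3)] show ?thesis by (simp add: power_mult_distrib)
qed

text \<open>The greatest element exists because \<open>radius_bound\<close> bounds all \<open>N\<close> with the property.\<close>

lemma N_of_works:
  assumes "0 < r" "r < sqrt 2 / 4" "N_defined r"
  shows "N_of r > 1" "eta r < beta (N_of r) / 2"
proof -
  define P where "P N \<longleftrightarrow> N > 1 \<and> eta r < beta N / 2" for N
  obtain N0 where "P N0" using assms(3) by (auto simp: N_defined_def P_def)
  moreover have "N \<le> nat \<lceil>1 / (49 * r\<^sup>2) + 1\<rceil>" if "P N" for N
  proof -
    have "49 * r\<^sup>2 * real (N\<^sup>2 - 1) \<le> 1" using that assms by (intro radius_bound) (auto simp: P_def)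
    then have "real (N\<^sup>2 - 1) \<le> 1 / (49 * r\<^sup>2)" using assms(1) by (simp add: field_simps)
    moreover have "N \<le> N\<^sup>2" by (simp add: power2_eq_square)
    then have "real N \<le> real (N\<^sup>2 - 1) + 1" by linarith
    ultimately show ?thesis by linarith
  qed
  ultimately have "P (Greatest P)" by (intro GreatestI_nat[of P N0 "nat \<lceil>1 / (49 * r\<^sup>2) + 1\<rceil>"]) auto
  then show "N_of r > 1" "eta r < beta (N_of r) / 2" 
    by (simp_all add: N_of_def P_def[abs_def])
qed

text \<open>The form in which the angle condition is used. Applying the bound \<open>beta N\<close> to \<open>u\<close> and to
  \<open>- u\<close> shows that the lines of \<open>u\<close> and \<open>v\<close> form an angle whose sine is at least
  \<open>sin (beta N) \<ge> 7 * r\<close>.\<close>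

lemma gram_short_vectors:
  fixes u v :: "int ^ 'm"
  assumes r: "0 < r" "r < sqrt 2 / 4" "N > 1" "eta r < beta N / 2"
    and uv: "norm (of_int_vec u) < real N" "norm (of_int_vec v) < real N"
    and g: "gram (of_int_vec u) (of_int_vec v) > 0"
  shows "49 * r\<^sup>2 * ((of_int_vec u \<bullet> of_int_vec u) * (of_int_vec v \<bullet> of_int_vec v)) \<le> gram (of_int_vec u) (of_int_vec v)"
proof -
  let ?V = "of_int_vec :: int ^ 'm \<Rightarrow> real ^ 'm"
  define x where "x = (?V u \<bullet> ?V v) / (norm (?V u) * norm (?V v))"
  have V0: "?V 0 = 0" by (simp add: of_int_vec_def vec_eq_iff)
  have u0: "u \<noteq> 0" "v \<noteq> 0" using g V0 by (auto simp: gram_def)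
  have nz: "norm (?V u) \<noteq> 0" "norm (?V v) \<noteq> 0" using g by (auto simp: gram_def)
  define n where "n = (?V u \<bullet> ?V u) * (?V v \<bullet> ?V v)"
  have n: "n = (norm (?V u) * norm (?V v))\<^sup>2" by (simp add: n_def power_mult_distrib power2_norm_eq_inner)
  have n0: "0 < n" using nz by (simp add: n)
  have gx: "gram (?V u) (?V v) = n * (1 - x\<^sup>2)"
    using n0 by (simp add: gram_def flip: n_def) (simp add: x_def power_divide right_diff_distrib flip: n)
  have "x\<^sup>2 < 1" using g n0 by (simp add: gx zero_less_mult_iff)
  then have x1: "\<bar>x\<bar> < 1" by (simp add: abs_square_less_1)
  have le_cos: "y \<le> cos (beta N)" 
    if ab: "a \<noteq> 0" "b \<noteq> 0" "norm (?V a) < real N" "norm (?V b) < real N"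
      and y: "y = (?V a \<bullet> ?V b) / (norm (?V a) * norm (?V b))" "\<bar>y\<bar> < 1" for a b y
  proof -
    obtain a' b' where ab': "a' \<in> short_vectors (2 * N\<^sup>2 - 2) N" "b' \<in> short_vectors (2 * N\<^sup>2 - 2) N"
      "Zd_angle (2 * N\<^sup>2 - 2) a' b' = arccos y"
      using Zd_vectors_of_int_vecs[OF ab] y(1) by metis
    have ac: "0 < arccos y" "arccos y \<le> pi" using y(2) arccos_lt_bounded[of y] by (auto simp: abs_less_iff)
    then have "beta N \<le> arccos y" using beta_le_angle(1)[OF ab'(1,2)] ab'(3) by simp
    then have "cos (arccos y) \<le> cos (beta N)" 
      using ac beta_small(1)[OF r(3)] by (intro cos_monotone_0_pi_le) auto
    then show ?thesis using y(2) by simp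
  qed
  have neg: "?V (- u) = - ?V u" by (simp add: of_int_vec_def vec_eq_iff)
  have "x \<le> cos (beta N)" by (rule le_cos[OF u0 uv x_def x1])
  moreover have "- x \<le> cos (beta N)"
    by (rule le_cos[of "-u" v]) (use u0 uv x1 in \<open>auto simp: neg x_def\<close>)
  ultimately have "\<bar>x\<bar> \<le> \<bar>cos (beta N)\<bar>" by linarith
  then have "x\<^sup>2 \<le> (cos (beta N))\<^sup>2" by (rule abs_le_square_iff[THEN iffD1])
  then have "(sin (beta N))\<^sup>2 \<le> 1 - x\<^sup>2" by (simp add: sin_squared_eq)
  moreover have "(7 * r)\<^sup>2 \<le> (sin (beta N))\<^sup>2" using radius_le_sin_beta[OF r] r(1) by (intro power_mono) auto
  ultimately have "49 * r\<^sup>2 \<le> 1 - x\<^sup>2" by (simp add: power_mult_distrib)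
  then have "n * (49 * r\<^sup>2) \<le> n * (1 - x\<^sup>2)" using n0 by (intro mult_left_mono) auto
  then show ?thesis by (simp add: gx n_def mult_ac)
qed

section \<open>Integer vectors and steps\<close>

lemma of_int_vec_simps [simp]:
  "of_int_vec (0 :: int ^ 'm) = 0"
  "of_int_vec (a + b) = of_int_vec a + of_int_vec (b :: int ^ 'm)"
  "of_int_vec (a - b) = of_int_vec a - of_int_vec b"
  "of_int_vec (- a) = - of_int_vec a"
  by (simp_all add: of_int_vec_def vec_eq_iff)

lemma of_int_vec_eq_iff [simp]: "of_int_vec a = of_int_vec b \<longleftrightarrow> a = (b :: int ^ 'm)"
  by (simp add: of_int_vec_def vec_eq_iff)

lemma of_int_vec_eq_0_iff [simp]: "of_int_vec a = 0 \<longleftrightarrow> a = (0 :: int ^ 'm)"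
  using of_int_vec_eq_iff[of a 0] by (simp del: of_int_vec_eq_iff)

lemma of_int_vec_inner: "of_int_vec a \<bullet> of_int_vec b = real_of_int (\<Sum>i\<in>UNIV. a $ i * b $ i)"
  for a :: "int ^ 'm"
  by (simp add: inner_vec_def of_int_vec_def)

lemma norm_of_int_vec_ge_1:
  fixes a :: "int ^ 'm"
  assumes "a \<noteq> 0"
  shows "1 \<le> norm (of_int_vec a)"
proof -
  obtain k :: int where k: "(norm (of_int_vec a))\<^sup>2 = of_int k"
    unfolding power2_norm_eq_inner of_int_vec_inner by blast
  moreover have "0 < (norm (of_int_vec a))\<^sup>2" using assms by simp
  ultimately have "1 \<le> (norm (of_int_vec a))\<^sup>2" by simp
  then show ?thesis using power2_le_imp_le[of 1 "norm (of_int_vec a)"] by simp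
qed

lemma ex_least_int_valued:
  fixes f :: "'a \<Rightarrow> real"
  assumes "P a" and f: "\<And>x. \<exists>k. f x = of_int k" "\<And>x. 0 \<le> f x"
  obtains b where "P b" "\<And>c. P c \<Longrightarrow> f b \<le> f c"
proof -
  obtain b where b: "P b" "\<And>c. P c \<Longrightarrow> nat \<lfloor>f b\<rfloor> \<le> nat \<lfloor>f c\<rfloor>"
    using ex_has_least_nat[of P, OF assms(1), of "\<lambda>x. nat \<lfloor>f x\<rfloor>"] by blast
  have "f x = real (nat \<lfloor>f x\<rfloor>)" for x using f(1)[of x] f(2)[of x] by auto
  then have "f b \<le> f c" if "P c" for c using b(2)[OF that] by (metis of_nat_le_iff)
  with b(1) that show thesis by blast
qed

text \<open>If the obstacles lie in balls of radius \<open>r\<close> and \<open>\<rho> = 2 * r\<close>, then no obstacle lies between those at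
  \<open>0\<close> and \<open>v\<close>: a point of the convex hull is within \<open>r\<close> of the segment of centres, and so is
  within \<open>r\<close> of its own centre.\<close>

definition isolated_step :: "real \<Rightarrow> int ^ 'm \<Rightarrow> bool" where
  "isolated_step \<rho> v \<longleftrightarrow> v \<noteq> 0 \<and>
     (\<forall>l t. 0 \<le> t \<longrightarrow> t \<le> 1 \<longrightarrow> norm (of_int_vec l - t *\<^sub>R of_int_vec v) \<le> \<rho> \<longrightarrow> l = 0 \<or> l = v)"

text \<open>In the same way, after the steps \<open>a\<close> and \<open>b\<close> the middle obstacle is not between the two
  others.\<close>

definition turning :: "real \<Rightarrow> int ^ 'm \<Rightarrow> int ^ 'm \<Rightarrow> bool" where
  "turning \<rho> a b \<longleftrightarrow> 
     (\<forall>t. 0 \<le> t \<longrightarrow> t \<le> 1 \<longrightarrow> \<rho> < norm (of_int_vec a - t *\<^sub>R of_int_vec (a + b)))"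

text \<open>The parallelogram of \<open>a\<close> and \<open>a + b\<close> has the area of that of \<open>a\<close> and \<open>b\<close>. Divided by
  \<open>norm (a + b)\<close>, this is the distance of \<open>a\<close> from the line of \<open>a + b\<close>.\<close>

lemma turning_if_gram:
  fixes a b :: "int ^ 'm"
  assumes "\<rho>\<^sup>2 * (norm (of_int_vec (a + b)))\<^sup>2 < gram (of_int_vec a) (of_int_vec b)"
  shows "turning \<rho> a b"
  unfolding turning_def
proof (intro allI impI, rule ccontr)
  fix t :: real
  let ?a = "of_int_vec a :: real ^ 'm" and ?b = "of_int_vec b :: real ^ 'm"
  define s where "s = ?a + ?b"
  define q where "q = ?a - t *\<^sub>R s"
  assume "\<not> \<rho> < norm (of_int_vec a - t *\<^sub>R of_int_vec (a + b))"
  then have "norm q \<le> \<rho>" by (simp add: q_def s_def)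
  have "gram ?a ?b = gram ?a (?b + 1 *\<^sub>R ?a)" by (rule gram_add_multiple[symmetric])
  also have "\<dots> = gram s (t *\<^sub>R s + q)" 
    by (subst gram_commute) (simp add: s_def q_def add.commute)
  also have "\<dots> \<le> (s \<bullet> s) * (norm q)\<^sup>2" by (rule gram_le_dist)
  also have "\<dots> \<le> (s \<bullet> s) * \<rho>\<^sup>2" using \<open>norm q \<le> \<rho>\<close> by (intro mult_left_mono power_mono) auto
  finally show False using assms by (simp add: s_def power2_norm_eq_inner mult.commute)
qed

lemma ex_small_coordinate:
  fixes x :: "real ^ 'm"
  assumes "CARD('m) \<ge> 2"
  obtains i where "(x $ i)\<^sup>2 \<le> (x \<bullet> x) / 2"
proof -
  obtain i j :: 'm where ij: "i \<noteq> j"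
    using assms by (metis card_le_Suc0_iff_eq finite_class.finite_UNIV UNIV_I not_less_eq_eq numeral_2_eq_2)
  have "(\<Sum>k\<in>{i, j}. x $ k * x $ k) \<le> (\<Sum>k\<in>UNIV. x $ k * x $ k)"
    by (intro sum_mono2) auto
  then have "(x $ i)\<^sup>2 + (x $ j)\<^sup>2 \<le> x \<bullet> x" using ij by (simp add: inner_vec_def power2_eq_square)
  then show thesis using that[of i] that[of j] by argo
qed

lemma of_int_vec_axis: "of_int_vec (axis i s) = axis i (real_of_int s)"
  by (simp add: of_int_vec_def axis_def vec_eq_iff)

lemma of_int_vec_valued: "\<exists>k. of_int_vec a \<bullet> of_int_vec b = real_of_int k"
  unfolding of_int_vec_inner by blast

section \<open>Long isolated steps in every direction\<close>

text \<open>What remains of the hypothesis \<open>eta r < beta N / 2\<close>. The argument \<open>dim\<close> only fixes the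
  dimension.\<close>

locale short_vector_gap =
  fixes r :: real and N :: nat and dim :: "'m::finite itself"
  assumes r_pos: "0 < r" and N: "1 < N" and two_dims: "CARD('m) \<ge> 2"
    and radius: "49 * r\<^sup>2 * ((real N)\<^sup>2 - 1) \<le> 1"
    and gap: "\<And>u v :: int ^ 'm. norm (of_int_vec u) < real N \<Longrightarrow> norm (of_int_vec v) < real N \<Longrightarrow>
      0 < gram (of_int_vec u) (of_int_vec v) \<Longrightarrow>
      49 * r\<^sup>2 * ((of_int_vec u \<bullet> of_int_vec u) * (of_int_vec v \<bullet> of_int_vec v)) \<le> gram (of_int_vec u) (of_int_vec v)"
begin

abbreviation V :: "int ^ 'm \<Rightarrow> real ^ 'm" where "V \<equiv> of_int_vec"

lemma r_sq: "147 * r\<^sup>2 \<le> 1"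
proof -
  have "2\<^sup>2 \<le> (real N)\<^sup>2" using N by (intro power_mono) auto
  then have "49 * r\<^sup>2 * 3 \<le> 49 * r\<^sup>2 * ((real N)\<^sup>2 - 1)" by (intro mult_left_mono) auto
  with radius show ?thesis by simp
qed

lemma r_small: "12 * r < 1"
proof -
  have "0 < r\<^sup>2" using r_pos by simp
  then have "(12 * r)\<^sup>2 < 1\<^sup>2" using r_sq unfolding power_mult_distrib by simp
  then show ?thesis using r_pos by (intro power2_less_imp_less[of "12 * r" 1]) auto
qed

text \<open>Dirichlet's theorem on simultaneous approximation, applied to the coordinates of \<open>e\<close>. What
  matters is that \<open>M\<close> is the same for all \<open>e\<close>.\<close>

lemma ex_tube_vector:
  "\<exists>M. \<forall>e :: real ^ 'm. norm e = 1 \<longrightarrow> (\<exists>k. k \<noteq> 0 \<and> norm (perp e (V k)) \<le> 4 * r \<and> norm (V k) \<le> M)"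
proof -
  define m where "m = CARD('m)"
  define Q where "Q = nat \<lceil>real m / (4 * r)\<rceil> + 1"
  have Q: "Q > 0" "real m * (1 / real Q) \<le> 4 * r"
  proof -
    have "real m / (4 * r) \<le> real Q" unfolding Q_def by linarith
    then have "real m \<le> real Q * (4 * r)" using r_pos by (simp add: pos_divide_le_eq)
    moreover have "0 < real Q" by (simp add: Q_def)
    ultimately show "real m * (1 / real Q) \<le> 4 * r" by (simp add: pos_divide_le_eq mult.commute)
  qed (simp add: Q_def)
  obtain h :: "nat \<Rightarrow> 'm" where h: "bij_betw h {..<m} UNIV"
    using ex_bij_betw_nat_finite[of "UNIV :: 'm set"] by (auto simp: m_def atLeast0LessThan)
  have "\<exists>k. k \<noteq> 0 \<and> norm (perp e (V k)) \<le> 4 * r \<and> norm (V k) \<le> real (Q ^ m) + 1" 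
    if e: "norm e = 1" for e :: "real ^ 'm"
  proof -
    obtain q p where q: "0 < q" "q \<le> int (Q ^ m)"
      and p: "\<And>i. i < m \<Longrightarrow> \<bar>of_int q * e $ h i - of_int (p i)\<bar> < 1 / Q"
      using Dirichlet_approx_simult[OF Q(1), of m "\<lambda>i. e $ h i"] by metis
    define k :: "int ^ 'm" where "k = (\<chi> j. p (the_inv_into {..<m} h j))"
    have k: "k $ h i = p i" if "i < m" for i
      using that h by (simp add: k_def the_inv_into_f_f bij_betw_def)
    define d where "d = V k - of_int q *\<^sub>R e"
    have "norm d \<le> (\<Sum>j\<in>UNIV. \<bar>d $ j\<bar>)" by (rule norm_le_l1_cart)
    also have "\<dots> = (\<Sum>i<m. \<bar>d $ h i\<bar>)" by (rule sum.reindex_bij_betw[OF h, symmetric])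
    also have "\<dots> \<le> (\<Sum>i<m. 1 / Q)"
    proof (rule sum_mono)
      fix i assume "i \<in> {..<m}"
      then show "\<bar>d $ h i\<bar> \<le> 1 / Q" using p[of i] k[of i] by (simp add: d_def of_int_vec_def abs_minus_commute)
    qed
    also have "\<dots> \<le> 4 * r" using Q by simp
    finally have d: "norm d \<le> 4 * r" .
    have Vk: "V k = of_int q *\<^sub>R e + d" by (simp add: d_def)
    have "perp e (V k) = perp e d" unfolding Vk by (simp add: perp_simps)
    then have 1: "norm (perp e (V k)) \<le> 4 * r" using d norm_perp_le[of e d] by simp
    have nq: "norm (of_int q *\<^sub>R e) = of_int q" using e q by simp
    have "norm (V k) \<le> of_int q + 4 * r" unfolding Vk using norm_triangle_ineq[of "of_int q *\<^sub>R e" d] d nq by simp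
    moreover have "of_int q \<le> real (Q ^ m)" using q(2) by (metis of_int_le_iff of_int_of_nat_eq)
    ultimately have 2: "norm (V k) \<le> real (Q ^ m) + 1" using r_small r_pos by linarith
    have "k \<noteq> 0"
    proof
      assume "k = 0"
      then have "d = - (of_int q *\<^sub>R e)" by (simp add: d_def)
      then have "norm d = of_int q" using nq by simp
      moreover have "1 \<le> real_of_int q" using q by simp
      ultimately show False using d r_small r_pos by linarith
    qed
    with 1 2 show ?thesis by blast
  qed
  then show ?thesis by blast
qed

text \<open>If \<open>l\<close> is close to the first half of the segment from \<open>0\<close> to \<open>u\<close>, its component orthogonal
  to \<open>e\<close> is at most half of that of \<open>u\<close> plus \<open>2 * r\<close>. So \<open>l\<close> is again in the tube, and shorter. For
  the second half, \<open>u - l\<close> takes the place of \<open>l\<close>.\<close>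

lemma shortest_tube_vector_isolated:
  fixes e :: "real ^ 'm"
  assumes "u \<noteq> 0" "norm (perp e (V u)) \<le> 4 * r"
    and least: "\<And>l. l \<noteq> 0 \<Longrightarrow> norm (perp e (V l)) \<le> 4 * r \<Longrightarrow> norm (V u) \<le> norm (V l)"
  shows "isolated_step (2 * r) u"
proof -
  have far_half: False if "l \<noteq> 0" "0 \<le> t" "t \<le> 1/2" "norm (V l - t *\<^sub>R V u) \<le> 2 * r" for l t
  proof -
    define q where "q = V l - t *\<^sub>R V u"
    have l: "V l = t *\<^sub>R V u + q" by (simp add: q_def)
    have q: "norm q \<le> 2 * r" using that by (simp add: q_def)
    have "norm (perp e (V l)) \<le> t * norm (perp e (V u)) + norm (perp e q)"
      unfolding l perp_simps using norm_triangle_ineq[of "t *\<^sub>R perp e (V u)" "perp e q"] that by simp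
    also have "\<dots> \<le> (1/2) * (4 * r) + 2 * r"
      using that assms norm_perp_le[of e q] q by (intro add_mono mult_mono) auto
    finally have "norm (V u) \<le> norm (V l)" using that by (intro least) auto
    also have "\<dots> \<le> t * norm (V u) + norm q" 
      unfolding l using norm_triangle_ineq[of "t *\<^sub>R V u" q] that by simp
    also have "\<dots> \<le> (1/2) * norm (V u) + 2 * r" using that q by (intro add_mono mult_right_mono) auto
    finally show False using norm_of_int_vec_ge_1[OF assms(1)] r_small r_pos by simp
  qed
  show ?thesis unfolding isolated_step_def
  proof (intro conjI assms allI impI)
    fix l and t :: real
    assume t: "0 \<le> t" "t \<le> 1" and l: "norm (V l - t *\<^sub>R V u) \<le> 2 * r"
    show "l = 0 \<or> l = u"
    proof (cases "t \<le> 1/2")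
      case True
      then show ?thesis using far_half[of l t] t l by auto
    next
      case False
      have "V (u - l) - (1 - t) *\<^sub>R V u = - (V l - t *\<^sub>R V u)" by (simp add: algebra_simps)
      then have "norm (V (u - l) - (1 - t) *\<^sub>R V u) \<le> 2 * r" using l by (metis norm_minus_cancel)
      then show ?thesis using far_half[of "u - l" "1 - t"] t False by auto
    qed
  qed
qed

text \<open>Among the integer vectors outside the line of \<open>u\<close>, let \<open>sqrt H\<close> be the least distance from
  that line; the angle condition gives \<open>sqrt H \<ge> 7 * r\<close>. All vectors \<open>x n\<close> of one
  nearest coset have this distance. An integer vector \<open>l\<close> near the segment from \<open>0\<close> to \<open>w = x n\<close> is
  in the line of \<open>u\<close>, or \<open>w - l\<close> is: otherwise \<open>l\<close> and \<open>w - l\<close> both have distance at least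
  \<open>sqrt H\<close> from it, against \<open>convex_split_bound\<close> for the components orthogonal to \<open>u\<close>.
  By \<open>prim\<close>, an integer vector in the line of \<open>u\<close> is at least as long as \<open>u\<close>, so it
  is near the segment only if \<open>u\<close> is near the line of \<open>w\<close>, that is if
  \<open>norm w\<close> is at least \<open>sqrt B\<close>. So \<open>w\<close> is taken as the last vector before the sequence
  reaches the norm \<open>sqrt B\<close>; being almost that long, it is almost parallel to \<open>u\<close>. It has
  norm at least \<open>N\<close> because two nonparallel vectors shorter than that would form a larger angle.\<close>

lemma long_isolated_near_short:
  assumes u: "u \<noteq> 0" "norm (V u) < real N"
    and prim: "\<And>l j. l \<noteq> 0 \<Longrightarrow> V l = j *\<^sub>R V u \<Longrightarrow> 1 \<le> \<bar>j\<bar>"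
  obtains w where "isolated_step (2 * r) w" "real N \<le> norm (V w)" "norm (V w) \<le> real N / (2 * r)"
    "norm (perp (V u) (V w)) \<le> 3 * r * norm (V w)" "0 < V w \<bullet> V u"
proof -
  define g where "g l = gram (V u) (V l)" for l
  define U where "U = V u \<bullet> V u"
  have U: "U = (norm (V u))\<^sup>2" by (simp add: U_def power2_norm_eq_inner)
  have u1: "1 \<le> norm (V u)" by (rule norm_of_int_vec_ge_1[OF u(1)])
  then have U1: "1 \<le> U" by (simp add: U)
  have UN: "U \<le> (real N)\<^sup>2" unfolding U using u by (intro power_mono) auto
  obtain i where i: "((V u) $ i)\<^sup>2 \<le> U / 2" using ex_small_coordinate[OF two_dims] unfolding U_def by blast
  have gi: "g (axis i 1) = U - ((V u) $ i)\<^sup>2"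
    by (simp add: g_def gram_def of_int_vec_axis U_def inner_axis)
  have gi0: "0 < g (axis i 1)" using gi i U1 by simp
  have gint: "\<exists>k. g l = of_int k" for l
  proof -
    obtain a b c where "V u \<bullet> V u = real_of_int a" "V l \<bullet> V l = real_of_int b" "V u \<bullet> V l = real_of_int c"
      using of_int_vec_valued[of u u] of_int_vec_valued[of l l] of_int_vec_valued[of u l] by blast
    then have "g l = of_int (a * b - c\<^sup>2)" by (simp add: g_def gram_def)
    then show ?thesis by blast
  qed
  obtain v0 where v0: "0 < g v0" "\<And>l. 0 < g l \<Longrightarrow> g v0 \<le> g l"
    by (rule ex_least_int_valued[where P = "\<lambda>l. 0 < g l" and f = g, OF gi0 gint]) 
       (auto simp: g_def gram_nonneg)
  define D where "D = g v0"
  have D: "0 < D" "D \<le> U" using v0(1) v0(2)[OF gi0] gi zero_le_power2[of "V u $ i"] unfolding D_def by linarith+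
  define H where "H = D / U"
  have DH: "D = U * H" using U1 by (simp add: H_def)
  have gH: "g l = U * (norm (perp (V u) (V l)))\<^sup>2" for l by (simp add: g_def gram_perp U_def)
  have g_shift: "g (l + m) = g l" if "V m = t *\<^sub>R V u" for l m t
    using that by (simp add: g_def gram_add_multiple)
  \<comment> \<open>Adding a multiple of \<open>u\<close> keeps the distance from the line of \<open>u\<close>; rounding the coordinate
    along \<open>u\<close> makes the representative short.\<close>
  define s0 where "s0 = (V v0 \<bullet> V u) / U"
  define mul where "mul n = (\<chi> i. n * u $ i)" for n :: int
  have Vmul: "V (mul n) = of_int n *\<^sub>R V u" for n by (simp add: mul_def of_int_vec_def vec_eq_iff)
  define v1 where "v1 = v0 + mul (- round s0)"
  define s where "s = (V v1 \<bullet> V u) / U"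
  have "s = s0 - of_int (round s0)" using U1
    by (simp add: s_def s0_def v1_def Vmul inner_diff_left diff_divide_distrib flip: U_def)
  then have s: "\<bar>s\<bar> \<le> 1/2" using of_int_round_abs_le[of s0] by (simp add: abs_minus_commute)
  define x where "x n = v1 + mul (int n)" for n
  have gx: "g (x n) = D" for n
    unfolding x_def v1_def D_def by (simp add: g_shift[OF Vmul])
  then have px: "(norm (perp (V u) (V (x n))))\<^sup>2 = H" for n using gH[of "x n"] U1 by (simp add: H_def)
  have sx: "(V (x n) \<bullet> V u) / U = s + real n" for n using U1
    by (simp add: x_def s_def Vmul inner_add_left add_divide_distrib flip: U_def)
  have nx: "(norm (V (x n)))\<^sup>2 = (s + real n)\<^sup>2 * U + H" for n
    using norm_sq_perp[of "V (x n)" "V u"] px[of n] sx[of n] by (simp add: U_def)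
  have H: "49 * r\<^sup>2 \<le> H"
  proof (cases "norm (V (x 0)) < real N")
    case True
    have "49 * r\<^sup>2 * (U * (norm (V (x 0)))\<^sup>2) \<le> D"
      using gap[OF u(2) True] gx[of 0] D(1) by (simp add: g_def U_def power2_norm_eq_inner)
    moreover have "1 \<le> (norm (V (x 0)))\<^sup>2"
    proof -
      have "x 0 \<noteq> 0" using gx[of 0] D(1) by (auto simp: g_def gram_def)
      then show ?thesis using norm_of_int_vec_ge_1[of "x 0"] by simp
    qed
    then have "49 * r\<^sup>2 * (U * 1) \<le> 49 * r\<^sup>2 * (U * (norm (V (x 0)))\<^sup>2)"
      using U1 by (intro mult_left_mono) auto
    ultimately have "49 * r\<^sup>2 * (U * 1) \<le> D" by (rule order_trans[rotated])
    then show ?thesis using U1 by (simp add: H_def field_simps)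
  next
    case False
    then have "(real N)\<^sup>2 \<le> (norm (V (x 0)))\<^sup>2" by (intro power_mono) auto
    moreover have "s\<^sup>2 * U \<le> (1/2)\<^sup>2 * (real N)\<^sup>2" 
      using s UN U1 by (intro mult_mono) (auto simp: abs_le_square_iff[symmetric])
    moreover have "2\<^sup>2 \<le> (real N)\<^sup>2" using N by (intro power_mono) auto
    ultimately have "1 \<le> H" using nx[of 0] by (simp add: power2_eq_square)
    then show ?thesis using r_sq by simp
  qed
  \<comment> \<open>The distance of \<open>u\<close> from the line of \<open>w\<close> is \<open>sqrt D / norm w\<close>; it exceeds \<open>2 * r\<close> exactly
    if \<open>(norm w)\<^sup>2 < B\<close>.\<close>
  define B where "B = D / (4 * r\<^sup>2)"
  have r2: "0 < r\<^sup>2" using r_pos by simp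
  have H0: "0 < H" using H r2 by linarith
  \<comment> \<open>Before the norm \<open>sqrt B\<close> there are at least the first two members of the coset, whose
    coordinates along \<open>u\<close> are at most \<open>3/2\<close>. So the last one has index at least one, and points
    forward.\<close>
  have start: "H + 9/4 * U < B"
  proof -
    have "49 * r\<^sup>2 * U \<le> H * U" using H U1 by (intro mult_right_mono) auto
    moreover have "147 * r\<^sup>2 * (U * H) \<le> 1 * (U * H)"
      using r_sq U1 D by (intro mult_right_mono) (auto simp: DH[symmetric])
    moreover have "1 * H \<le> U * H" using U1 H0 by (intro mult_right_mono) auto
    moreover from this have "r\<^sup>2 * H \<le> r\<^sup>2 * (U * H)" by (intro mult_left_mono) auto
    ultimately have "4 * r\<^sup>2 * (H + 9/4 * U) < D"
      using D(1) unfolding DH by (simp add: algebra_simps)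
    then show ?thesis using r2 by (simp add: B_def field_simps)
  qed
  have "\<exists>n. B \<le> (norm (V (x n)))\<^sup>2"
  proof
    define n where "n = nat \<lceil>B\<rceil> + 1"
    have B0: "0 < B" using D r2 by (simp add: B_def)
    have "B + 1 \<le> real n" unfolding n_def by linarith
    then have n: "B + 1/2 \<le> s + real n" using s by linarith
    have "B \<le> (B + 1/2)\<^sup>2" by (simp add: power2_eq_square algebra_simps)
    also have "\<dots> \<le> (s + real n)\<^sup>2" using n B0 by (intro power_mono) auto
    also have "\<dots> \<le> (s + real n)\<^sup>2 * U" using U1 by (simp add: mult_le_cancel_left1)
    also have "\<dots> \<le> (norm (V (x n)))\<^sup>2" using H0 unfolding nx by simp
    finally show "B \<le> (norm (V (x n)))\<^sup>2" .
  qed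
  define k where "k = (LEAST n. B \<le> (norm (V (x n)))\<^sup>2)"
  have k: "B \<le> (norm (V (x k)))\<^sup>2" unfolding k_def by (rule LeastI_ex) fact
  have small: "(norm (V (x n)))\<^sup>2 < B" if "n \<le> 1" for n
  proof -
    have "real n \<le> 1" using that by simp
    then have "\<bar>s + real n\<bar> \<le> \<bar>3/2\<bar>" using s by linarith
    then have "(s + real n)\<^sup>2 \<le> (3/2)\<^sup>2" by (rule abs_le_square_iff[THEN iffD1])
    then have "(s + real n)\<^sup>2 * U \<le> (3/2)\<^sup>2 * U" using U1 by (intro mult_right_mono) auto
    then show ?thesis using start nx[of n] by (simp add: power2_eq_square)
  qed
  have k2: "2 \<le> k" using small[of k] k by (cases "k \<le> 1") auto
  define w where "w = x (k - 1)"
  have wB: "(norm (V w))\<^sup>2 < B"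
    using not_less_Least[of "k - 1" "\<lambda>n. B \<le> (norm (V (x n)))\<^sup>2"] k2 by (simp add: w_def k_def)
  have xk: "x k = w + u"
    using k2 by (simp add: x_def w_def mul_def vec_eq_iff of_nat_diff algebra_simps)
  define b where "b = sqrt B"
  define h where "h = norm (perp (V u) (V w))"
  have h: "h\<^sup>2 = H" "0 \<le> h" by (simp_all add: h_def w_def px)
  have hr: "7 * r \<le> h" using H h by (intro power2_le_imp_le[of "7 * r"]) (auto simp: power_mult_distrib)
  have b: "b = norm (V u) * h / (2 * r)"
  proof -
    have "B = (norm (V u) * h / (2 * r))\<^sup>2"
      by (simp add: B_def DH U h(1)[symmetric] power_divide power_mult_distrib)
    then show ?thesis using h(2) r_pos by (simp add: b_def)
  qed
  have "b \<le> norm (V (x k))" unfolding b_def using k by (intro real_le_lsqrt) auto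
  also have "\<dots> \<le> norm (V w) + norm (V u)" by (simp add: xk norm_triangle_ineq)
  finally have bw: "b \<le> norm (V w) + norm (V u)" .
  have uh: "h \<le> norm (V u) * h" using u1 h(2) mult_right_mono[of 1 "norm (V u)" h] by simp
  have rb: "2 * r * b = norm (V u) * h" using r_pos by (simp add: b)
  have "7 * r * norm (V u) \<le> h * norm (V u)" using hr by (intro mult_right_mono) auto
  moreover have "r * b \<le> r * (norm (V w) + norm (V u))" using bw r_pos by (intro mult_left_mono) auto
  moreover have "0 \<le> r * norm (V w)" using r_pos by simp
  ultimately have hw: "h \<le> 3 * r * norm (V w)" using uh rb by (simp add: algebra_simps)
  have sw: "0 < V w \<bullet> V u"
  proof -
    have "0 < (V w \<bullet> V u) / U" unfolding w_def sx using s k2 by (simp add: of_nat_diff) 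
    then show ?thesis using U1 by (simp add: zero_less_divide_iff)
  qed
  then have w0: "w \<noteq> 0" by auto
  have gw: "g w = D" by (simp add: w_def gx)
  have wN: "real N \<le> norm (V w)"
  proof (rule ccontr)
    assume "\<not> real N \<le> norm (V w)"
    then have "49 * r\<^sup>2 * (U * (norm (V w))\<^sup>2) \<le> U * H"
      using gap[OF u(2), of w] gw D(1) by (simp add: g_def U_def power2_norm_eq_inner DH)
    also have "\<dots> \<le> U * (3 * r * norm (V w))\<^sup>2" unfolding h(1)[symmetric]
      using hw h(2) U1 by (intro mult_left_mono power_mono) auto
    finally have "U * (r\<^sup>2 * (norm (V w))\<^sup>2) \<le> 0" by (simp add: power_mult_distrib algebra_simps)
    moreover have "0 < U * (r\<^sup>2 * (norm (V w))\<^sup>2)" using U1 r2 w0 by (intro mult_pos_pos) auto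
    ultimately show False by simp
  qed
  have wM: "norm (V w) \<le> real N / (2 * r)"
  proof (rule power2_le_imp_le)
    have "B \<le> (real N)\<^sup>2 / (4 * r\<^sup>2)" unfolding B_def using D UN r2 by (intro divide_right_mono) auto
    then show "(norm (V w))\<^sup>2 \<le> (real N / (2 * r))\<^sup>2" using wB by (simp add: power_divide power_mult_distrib)
  qed (use r_pos in simp)
  have not_parallel: False if "l \<noteq> 0" "g l = 0" "norm (V l - t *\<^sub>R V w) \<le> 2 * r" for l t
  proof -
    define j where "j = (V l \<bullet> V u) / U"
    have "perp (V u) (V l) = 0" using that(2) gH[of l] U1 by simp
    then have Vl: "V l = j *\<^sub>R V u" by (simp add: perp_def j_def U_def)
    have "1 \<le> \<bar>j\<bar>" by (rule prim[OF that(1) Vl])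
    then have "1 \<le> j\<^sup>2" using abs_le_square_iff[of 1 j] by simp
    then have "1 * D \<le> j\<^sup>2 * D" using D by (intro mult_right_mono) auto
    also have "\<dots> = gram (V w) (t *\<^sub>R V w + (V l - t *\<^sub>R V w))"
      using gw by (simp add: Vl gram_commute[of "V w"] gram_scale g_def)
    also have "\<dots> \<le> (V w \<bullet> V w) * (norm (V l - t *\<^sub>R V w))\<^sup>2" by (rule gram_le_dist)
    also have "\<dots> \<le> (norm (V w))\<^sup>2 * (2 * r)\<^sup>2"
      using that(3) by (intro mult_mono power_mono) (auto simp: power2_norm_eq_inner)
    also have "\<dots> < B * (2 * r)\<^sup>2" using wB r_pos by (intro mult_strict_right_mono) auto
    finally show False using r_pos by (simp add: B_def power_mult_distrib)
  qed
  have "isolated_step (2 * r) w" unfolding isolated_step_def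
  proof (intro conjI w0 allI impI, rule ccontr)
    fix l and t :: real
    assume t: "0 \<le> t" "t \<le> 1" and l: "norm (V l - t *\<^sub>R V w) \<le> 2 * r" and "\<not> (l = 0 \<or> l = w)"
    then have l0: "l \<noteq> 0" "w - l \<noteq> 0" by auto
    have "V (w - l) - (1 - t) *\<^sub>R V w = - (V l - t *\<^sub>R V w)" by (simp add: algebra_simps)
    then have l': "norm (V (w - l) - (1 - t) *\<^sub>R V w) \<le> 2 * r" using l by (metis norm_minus_cancel)
    have far: "H \<le> (norm (perp (V u) (V a)))\<^sup>2" if "g a \<noteq> 0" for a
    proof -
      have "0 \<le> g a" by (simp add: g_def gram_nonneg)
      then have "D \<le> g a" using that v0(2)[of a] by (simp add: D_def)
      then show ?thesis using U1 by (simp add: gH DH)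
    qed
    define q where "q = perp (V u) (V l - t *\<^sub>R V w)"
    have q: "perp (V u) (V l) = t *\<^sub>R perp (V u) (V w) + q" by (simp add: q_def perp_simps)
    have "H \<le> (norm (perp (V u) (V w)))\<^sup>2 / 4 + (norm q)\<^sup>2"
    proof (rule convex_split_bound[OF t])
      show "H \<le> (norm (t *\<^sub>R perp (V u) (V w) + q))\<^sup>2"
        unfolding q[symmetric] using not_parallel[OF l0(1) _ l] by (intro far) auto
      have "H \<le> (norm (perp (V u) (V (w - l))))\<^sup>2"
        using not_parallel[OF l0(2) _ l'] by (intro far) auto
      then show "H \<le> (norm (perp (V u) (V w) - (t *\<^sub>R perp (V u) (V w) + q)))\<^sup>2"
        unfolding q[symmetric] by (simp add: perp_simps)
    qed
    moreover have "norm q \<le> 2 * r" using norm_perp_le[of "V u"] l unfolding q_def by (rule order_trans)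
    then have "(norm q)\<^sup>2 \<le> (2 * r)\<^sup>2" by (intro power_mono) auto
    ultimately show False using H r2 by (simp add: w_def px power_mult_distrib)
  qed
  then show thesis using that wN wM hw sw by (simp add: h_def)
qed

text \<open>The constant \<open>37\<close> collects the loss from two deviations: \<open>u\<close> from \<open>e\<close> with sine at most
  \<open>4 * r\<close>, and \<open>w\<close> from \<open>u\<close> with sine at most \<open>3 * r\<close>, so \<open>16 + 9 + 12 = 37\<close>.\<close>

lemma long_isolated_vector:
  "\<exists>M. \<forall>e :: real ^ 'm. norm e = 1 \<longrightarrow> (\<exists>v. isolated_step (2 * r) v \<and> real N \<le> norm (V v) \<and>
     norm (V v) \<le> M \<and> (1 - 37 * r\<^sup>2) * norm (V v) \<le> V v \<bullet> e)"
proof -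
  obtain M where M: "\<And>e :: real ^ 'm. norm e = 1 \<Longrightarrow> \<exists>k. k \<noteq> 0 \<and> norm (perp e (V k)) \<le> 4 * r \<and> norm (V k) \<le> M"
    using ex_tube_vector by blast
  have "\<exists>v. isolated_step (2 * r) v \<and> real N \<le> norm (V v) \<and>
     norm (V v) \<le> max M (real N / (2 * r)) \<and> (1 - 37 * r\<^sup>2) * norm (V v) \<le> V v \<bullet> e"
    if e: "norm e = 1" for e :: "real ^ 'm"
  proof -
    define T where "T l \<longleftrightarrow> l \<noteq> 0 \<and> norm (perp e (V l)) \<le> 4 * r" for l
    obtain k where k: "T k" "norm (V k) \<le> M" using M[OF e] by (auto simp: T_def)
    have "\<exists>j. V l \<bullet> V l = real_of_int j" for l by (rule of_int_vec_valued)
    then obtain u' where u': "T u'" "\<And>l. T l \<Longrightarrow> V u' \<bullet> V u' \<le> V l \<bullet> V l"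
      using ex_least_int_valued[where P = T and f = "\<lambda>l. V l \<bullet> V l", OF k(1)] by (auto simp del: inner_eq_zero_iff)
    define u where "u = (if 0 \<le> V u' \<bullet> e then u' else - u')"
    have Vu: "V u = V u' \<or> V u = - V u'" by (auto simp: u_def)
    have Tu: "T u" using u'(1) by (auto simp: T_def u_def perp_simps)
    have least: "norm (V u) \<le> norm (V l)" if "T l" for l
      using u'(2)[OF that] Vu by (auto simp: norm_le)
    have ue: "0 \<le> V u \<bullet> e" by (auto simp: u_def)
    have u0: "u \<noteq> 0" and pu: "norm (perp e (V u)) \<le> 4 * r" using Tu by (auto simp: T_def)
    have u1: "1 \<le> norm (V u)" by (rule norm_of_int_vec_ge_1[OF u0])
    have ee: "e \<bullet> e = 1" using e by (simp add: norm_eq_1)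
    have r2: "0 < r\<^sup>2" "r\<^sup>2 \<le> 1/147" using r_pos r_sq by auto
    have pu2: "(norm (perp e (V u)))\<^sup>2 \<le> (4 * r)\<^sup>2" using pu by (intro power_mono) auto
    show ?thesis
    proof (cases "real N \<le> norm (V u)")
      case True
      have "isolated_step (2 * r) u"
        by (rule shortest_tube_vector_isolated[OF u0 pu]) (auto simp: T_def intro: least)
      moreover have "norm (V u) \<le> M" using least[OF k(1)] k(2) by simp
      moreover have "(1 - 37 * r\<^sup>2) * norm (V u) \<le> V u \<bullet> e"
      proof (rule power2_le_imp_le[OF _ ue])
        have "1 \<le> (norm (V u))\<^sup>2" using u1 by simp
        then have "16 * r\<^sup>2 * 1 \<le> 16 * r\<^sup>2 * (norm (V u))\<^sup>2" by (intro mult_left_mono) auto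
        then have "(1 - 16 * r\<^sup>2) * (norm (V u))\<^sup>2 \<le> (V u \<bullet> e)\<^sup>2"
          using norm_sq_perp[of "V u" e] pu2 by (simp add: ee power_mult_distrib algebra_simps)
        moreover have "(1 - 37 * r\<^sup>2)\<^sup>2 \<le> 1 - 16 * r\<^sup>2"
        proof -
          have "37 * r\<^sup>2 * (37 * r\<^sup>2) \<le> 37 * r\<^sup>2 * 1" using r2 by (intro mult_left_mono) auto
          moreover have "(1 - 37 * r\<^sup>2)\<^sup>2 = 1 - 74 * r\<^sup>2 + 37 * r\<^sup>2 * (37 * r\<^sup>2)" by algebra
          ultimately show ?thesis using r2(1) by linarith
        qed
        then have "(1 - 37 * r\<^sup>2)\<^sup>2 * (norm (V u))\<^sup>2 \<le> (1 - 16 * r\<^sup>2) * (norm (V u))\<^sup>2"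
          by (intro mult_right_mono) auto
        ultimately show "((1 - 37 * r\<^sup>2) * norm (V u))\<^sup>2 \<le> (V u \<bullet> e)\<^sup>2"
          by (simp add: power_mult_distrib)
      qed
      ultimately show ?thesis using True by (intro exI[of _ u]) auto
    next
      case False
      have prim: "1 \<le> \<bar>j\<bar>" if "l \<noteq> 0" "V l = j *\<^sub>R V u" for l j
      proof (rule ccontr)
        assume "\<not> 1 \<le> \<bar>j\<bar>"
        then have j: "\<bar>j\<bar> < 1" by simp
        have "norm (perp e (V l)) = \<bar>j\<bar> * norm (perp e (V u))" by (simp add: that perp_simps)
        also have "\<dots> \<le> 1 * (4 * r)" using j pu by (intro mult_mono) auto
        finally have "norm (V u) \<le> norm (V l)" using that(1) by (intro least) (simp add: T_def)
        also have "\<dots> < 1 * norm (V u)" unfolding that(2) norm_scaleR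
          using j u1 by (intro mult_strict_right_mono) auto
        finally show False by simp
      qed
      have lt: "norm (V u) < real N" using False by simp
      obtain w where w: "isolated_step (2 * r) w" "real N \<le> norm (V w)" "norm (V w) \<le> real N / (2 * r)"
        "norm (perp (V u) (V w)) \<le> 3 * r * norm (V w)" "0 < V w \<bullet> V u"
        by (rule long_isolated_near_short[OF u0 lt]) (erule (1) prim, rule that)
      define n where "n = norm (V u)"
      have n: "V u \<bullet> V u = n\<^sup>2" "1 \<le> n" using u1 by (simp_all add: n_def power2_norm_eq_inner)
      define a b where "a = (V w \<bullet> V u) / n" and "b = (e \<bullet> V u) / n"
      have ab: "0 \<le> a" "0 \<le> b" using w(5) ue n(2) by (simp_all add: a_def b_def inner_commute)
      define p f where "p = perp (V u) (V w)" and "f = perp (V u) e"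
      have "gram (V u) e = gram e (V u)" by (rule gram_commute)
      then have "n\<^sup>2 * (norm f)\<^sup>2 = (norm (perp e (V u)))\<^sup>2" by (simp add: gram_perp n ee f_def)
      moreover have "1 * (norm f)\<^sup>2 \<le> n\<^sup>2 * (norm f)\<^sup>2" using n(2) by (intro mult_right_mono) auto
      ultimately have f2: "(norm f)\<^sup>2 \<le> (4 * r)\<^sup>2" using pu2 by linarith
      have f: "norm f \<le> 4 * r" by (rule power2_le_imp_le[OF f2]) (use r_pos in simp)
      have p: "norm p \<le> 3 * r * norm (V w)" using w(4) by (simp add: p_def)
      have p2: "(norm p)\<^sup>2 \<le> (3 * r * norm (V w))\<^sup>2" using p by (intro power_mono) auto
      have pythagoras: "(norm x)\<^sup>2 = ((x \<bullet> V u) / n)\<^sup>2 + (norm (perp (V u) x))\<^sup>2" for x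
      proof -
        have "((x \<bullet> V u) / n\<^sup>2)\<^sup>2 * n\<^sup>2 = ((x \<bullet> V u) / n)\<^sup>2" using n(2) by (simp add: power2_eq_square)
        then show ?thesis using norm_sq_perp[of x "V u"] by (simp add: n(1))
      qed
      have a2: "(1 - 9 * r\<^sup>2) * (norm (V w))\<^sup>2 \<le> a\<^sup>2"
        using pythagoras[of "V w"] p2 by (simp add: a_def p_def power_mult_distrib left_diff_distrib)
      have b2: "1 - 16 * r\<^sup>2 \<le> b\<^sup>2"
        using pythagoras[of e] f2 by (simp add: e b_def f_def power_mult_distrib)
      have sum: "V w \<bullet> e = a * b + p \<bullet> f"
      proof -
        have "V w = (a / n) *\<^sub>R V u + p" "e = (b / n) *\<^sub>R V u + f"
          by (simp_all add: p_def f_def a_def b_def perp_def n(1) power2_eq_square)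
        then have "V w \<bullet> e = ((a / n) *\<^sub>R V u + p) \<bullet> ((b / n) *\<^sub>R V u + f)"
          by (rule arg_cong2[where f = inner])
        also have "\<dots> = (a / n) * (b / n) * (V u \<bullet> V u) + p \<bullet> f"
          by (simp add: inner_add_left inner_add_right p_def f_def inner_commute[of "V u" "perp (V u) e"])
        finally have "V w \<bullet> e = (a / n) * (b / n) * (V u \<bullet> V u) + p \<bullet> f" .
        then show ?thesis using n(2) by (simp add: n(1) power2_eq_square)
      qed
      have "(1 - 25 * r\<^sup>2) * norm (V w) \<le> a * b"
      proof (rule power2_le_imp_le)
        have "(1 - 25 * r\<^sup>2)\<^sup>2 \<le> 1 - 25 * r\<^sup>2"
          using r2 mult_left_mono[of "25 * r\<^sup>2" 1 "25 * r\<^sup>2"] by (simp add: power2_eq_square algebra_simps)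
        also have "\<dots> \<le> (1 - 9 * r\<^sup>2) * (1 - 16 * r\<^sup>2)" by (simp add: algebra_simps)
        finally have "(1 - 25 * r\<^sup>2)\<^sup>2 * (norm (V w))\<^sup>2 \<le> (1 - 9 * r\<^sup>2) * (1 - 16 * r\<^sup>2) * (norm (V w))\<^sup>2"
          by (intro mult_right_mono) auto
        also have "\<dots> = ((1 - 9 * r\<^sup>2) * (norm (V w))\<^sup>2) * (1 - 16 * r\<^sup>2)" by simp
        also have "\<dots> \<le> a\<^sup>2 * b\<^sup>2" using a2 b2 r2 by (intro mult_mono) auto
        finally show "((1 - 25 * r\<^sup>2) * norm (V w))\<^sup>2 \<le> (a * b)\<^sup>2" by (simp add: power_mult_distrib)
      qed (use ab in simp)
      moreover have "\<bar>p \<bullet> f\<bar> \<le> (3 * r * norm (V w)) * (4 * r)"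
        using Cauchy_Schwarz_ineq2[of p f] mult_mono[OF p f] r_pos by simp
      ultimately have "(1 - 37 * r\<^sup>2) * norm (V w) \<le> V w \<bullet> e"
        unfolding sum by (simp add: algebra_simps power2_eq_square abs_le_iff)
      then show ?thesis using w by (intro exI[of _ w]) auto
    qed
  qed
  then show ?thesis by blast
qed

end

section \<open>Shortest paths are trajectory pieces\<close>

text \<open>Let \<open>u\<close> and \<open>w\<close> be the unit velocities before and after \<open>p\<close>. The length has gradient
  \<open>u - w\<close> at \<open>p\<close>, so minimality on a convex set means that \<open>w - u\<close> is an outer normal at \<open>p\<close>; it
  is not zero, since \<open>p\<close> is not on the segment from \<open>a\<close> to \<open>b\<close>. As \<open>u\<close> and \<open>w\<close> are unit
  vectors, the reflection in the hyperplane orthogonal to \<open>w - u\<close> exchanges them. Both sides stay beyond the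
  supporting hyperplane at \<open>p\<close>, so they do not meet the interior of \<open>S\<close>.\<close>

lemma reflection_at_shortest:
  fixes S :: "'a::euclidean_space set"
  assumes "convex S" "p \<in> S" "p \<notin> closed_segment a b"
    and least: "\<And>x. x \<in> S \<Longrightarrow> dist a p + dist p b \<le> dist a x + dist x b"
  shows "p \<in> frontier S" "reflects S p (sgn (p - a)) (sgn (b - p))"
    "closed_segment a p \<inter> interior S = {}" "closed_segment p b \<inter> interior S = {}"
proof -
  define u w where "u = sgn (p - a)" and "w = sgn (b - p)"
  have ne: "a \<noteq> p" "p \<noteq> b" using assms(3) by auto
  have nu: "norm u = 1" "norm w = 1" using ne by (auto simp: u_def w_def norm_sgn)
  have uu: "u \<bullet> u = 1" "w \<bullet> w = 1" using nu by (auto simp: norm_eq_1)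
  have pa: "p - a = norm (p - a) *\<^sub>R u" "b - p = norm (b - p) *\<^sub>R w" 
    using ne by (simp_all add: u_def w_def sgn_div_norm)
  have uw: "u \<noteq> w"
  proof
    assume "u = w"
    define A B where "A = norm (p - a)" and "B = norm (b - p)"
    have AB: "0 < A" "0 < B" using ne by (auto simp: A_def B_def)
    have "p - a = A *\<^sub>R u" "b - p = B *\<^sub>R u" using pa \<open>u = w\<close> by (simp_all add: A_def B_def)
    then have e: "a = p - A *\<^sub>R u" "b = p + B *\<^sub>R u" by (simp_all add: algebra_simps)
    have "p = (1 - A / (A + B)) *\<^sub>R a + (A / (A + B)) *\<^sub>R b"
    proof -
      have "(1 - A / (A + B)) *\<^sub>R a + (A / (A + B)) *\<^sub>R b 
          = p + ((A / (A + B)) * B - (1 - A / (A + B)) * A) *\<^sub>R u"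
        unfolding e by (simp add: algebra_simps)
      also have "(A / (A + B)) * B - (1 - A / (A + B)) * A = 0" using AB by (simp add: field_simps)
      finally show ?thesis by simp
    qed
    moreover have "0 \<le> A / (A + B)" "A / (A + B) \<le> 1" using AB by auto
    ultimately show False using assms(3) unfolding closed_segment_def by blast
  qed
  have u1w: "u \<bullet> w < 1"
  proof -
    have "0 < (u - w) \<bullet> (u - w)" using uw by simp
    then show ?thesis by (simp add: inner_diff_left inner_diff_right uu inner_commute)
  qed
  have norm_bound: "norm (z + t *\<^sub>R d) \<le> norm z + t * (sgn z \<bullet> d) + t\<^sup>2 * ((norm d)\<^sup>2 / (2 * norm z))"
    if "z \<noteq> 0" for z d :: 'a and t :: real
  proof -
    define n where "n = norm z"
    have n: "0 < n" using that by (simp add: n_def)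
    have "(norm (z + t *\<^sub>R d))\<^sup>2 = n\<^sup>2 + 2 * t * (z \<bullet> d) + t\<^sup>2 * (norm d)\<^sup>2"
      by (simp add: n_def power2_norm_eq_inner inner_add_left inner_add_right inner_commute[of d z] power2_eq_square[of t] algebra_simps)
    moreover have "2 * n * norm (z + t *\<^sub>R d) \<le> n\<^sup>2 + (norm (z + t *\<^sub>R d))\<^sup>2"
      using zero_le_power2[of "n - norm (z + t *\<^sub>R d)"] by (simp add: power2_diff)
    ultimately have "2 * n * norm (z + t *\<^sub>R d) \<le> 2 * n\<^sup>2 + 2 * t * (z \<bullet> d) + t\<^sup>2 * (norm d)\<^sup>2" by simp
    then have "norm (z + t *\<^sub>R d) \<le> (2 * n\<^sup>2 + 2 * t * (z \<bullet> d) + t\<^sup>2 * (norm d)\<^sup>2) / (2 * n)"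
      using n by (simp add: pos_le_divide_eq mult.commute)
    also have "\<dots> = n + t * ((z \<bullet> d) / n) + t\<^sup>2 * ((norm d)\<^sup>2 / (2 * n))"
      using n by (simp add: field_simps power2_eq_square)
    finally have "norm (z + t *\<^sub>R d) \<le> n + t * ((z \<bullet> d) / n) + t\<^sup>2 * ((norm d)\<^sup>2 / (2 * n))" .
    moreover have "sgn z \<bullet> d = (z \<bullet> d) / n" by (simp add: sgn_div_norm n_def divide_simps)
    ultimately show ?thesis by (simp only: n_def)
  qed
  have first_order: "0 \<le> (y - p) \<bullet> (u - w)" if y: "y \<in> S" for y
  proof (rule ccontr)
    define d where "d = y - p"
    define A where "A = d \<bullet> (u - w)"
    define C where "C = (norm d)\<^sup>2 / (2 * norm (p - a)) + (norm d)\<^sup>2 / (2 * norm (b - p))"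
    assume "\<not> 0 \<le> (y - p) \<bullet> (u - w)"
    then have A: "A < 0" by (simp add: A_def d_def)
    have C: "0 \<le> C" by (simp add: C_def)
    \<comment> \<open>So small that the quadratic term \<open>t\<^sup>2 * C\<close> is less than the first-order gain \<open>- t * A\<close>.\<close>
    define t where "t = min 1 (- A / (2 * (C + 1)))"
    have t: "0 < t" "t \<le> 1" "t \<le> - A / (2 * (C + 1))" using A C by (auto simp: t_def divide_pos_pos divide_neg_pos)
    have "0 < 2 * (C + 1)" using C by simp
    from pos_le_divide_eq[OF this, THEN iffD1, OF t(3)] have tC: "t * (2 * (C + 1)) \<le> - A" .
    have "(1 - t) *\<^sub>R p + t *\<^sub>R y \<in> S" using assms(1,2) y t by (intro convexD) auto
    then have "p + t *\<^sub>R d \<in> S" by (simp add: d_def algebra_simps)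
    from least[OF this] have "norm (p - a) + norm (b - p) \<le> norm ((p - a) + t *\<^sub>R d) + norm ((b - p) + t *\<^sub>R (- d))"
      by (simp add: dist_norm norm_minus_commute algebra_simps)
    also have "\<dots> \<le> (norm (p - a) + t * (u \<bullet> d) + t\<^sup>2 * ((norm d)\<^sup>2 / (2 * norm (p - a))))
        + (norm (b - p) + t * (w \<bullet> (- d)) + t\<^sup>2 * ((norm (- d))\<^sup>2 / (2 * norm (b - p))))"
      unfolding u_def w_def using ne by (intro add_mono norm_bound) auto
    also have "\<dots> = norm (p - a) + norm (b - p) + t * (A + t * C)"
      by (simp add: A_def C_def inner_diff_right inner_commute power2_eq_square algebra_simps)
    finally have "0 \<le> t * (A + t * C)" by simp
    then have "0 \<le> A + t * C" using t(1) by (simp add: zero_le_mult_iff)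
    moreover have "t * C + t * C \<le> - A" using tC t(1) by (simp add: algebra_simps)
    moreover have "0 \<le> t * C" using t(1) C by simp
    ultimately show False using A by linarith
  qed
  have not_int: "p \<notin> interior S"
  proof
    assume "p \<in> interior S"
    then obtain \<epsilon> where eps: "\<epsilon> > 0" "cball p \<epsilon> \<subseteq> S" by (meson mem_interior_cball)
    define y where "y = p + (\<epsilon> / 2) *\<^sub>R (w - u)"
    have "norm (w - u) \<le> 2" using norm_triangle_ineq4[of w u] nu by simp
    then have "y \<in> S" using eps by (intro subsetD[OF eps(2)]) (simp add: y_def dist_norm)
    from first_order[OF this] have "0 \<le> (\<epsilon> / 2) * ((w - u) \<bullet> (u - w))" by (simp add: y_def)
    moreover have "(w - u) \<bullet> (u - w) < 0" using u1w by (simp add: inner_diff_left inner_diff_right uu inner_commute)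
    ultimately show False using eps by (simp add: zero_le_mult_iff)
  qed
  show fr: "p \<in> frontier S" using not_int assms(2) closure_subset by (auto simp: frontier_def)
  define n where "n = (w - u) /\<^sub>R norm (w - u)"
  have wu: "(norm (w - u))\<^sup>2 = 2 * (1 - u \<bullet> w)"
    by (simp add: power2_norm_eq_inner inner_diff_left inner_diff_right uu inner_commute)
  have "outward_unit_normal S p n" unfolding outward_unit_normal_def
  proof (intro conjI fr ballI)
    show "norm n = 1" using uw by (simp add: n_def)
    fix y assume "y \<in> S"
    from first_order[OF this] have "(y - p) \<bullet> (w - u) \<le> 0" by (simp add: inner_diff_right)
    then show "(y - p) \<bullet> n \<le> 0" by (simp add: n_def mult_le_0_iff)
  qed
  moreover have un: "u \<bullet> n = - (1 - u \<bullet> w) / norm (w - u)"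
    by (simp add: n_def inner_diff_right uu divide_inverse mult.commute)
  then have "u \<bullet> n < 0" using u1w uw by (simp add: divide_neg_pos)
  moreover have "w = u - (2 * (u \<bullet> n)) *\<^sub>R n"
  proof -
    have "(2 * (u \<bullet> n)) *\<^sub>R n = (- (2 * (1 - u \<bullet> w)) / (norm (w - u))\<^sup>2) *\<^sub>R (w - u)"
      unfolding un by (simp add: n_def power2_eq_square divide_inverse)
    also have "- (2 * (1 - u \<bullet> w)) / (norm (w - u))\<^sup>2 = - 1" 
      unfolding wu using u1w by (subst minus_divide_left[symmetric]) simp
    finally show ?thesis by simp
  qed
  ultimately show "reflects S p (sgn (p - a)) (sgn (b - p))"
    unfolding reflects_def u_def[symmetric] w_def[symmetric] by blast
  show "closed_segment p b \<inter> interior S = {}"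
  proof (rule ccontr)
    assume "closed_segment p b \<inter> interior S \<noteq> {}"
    then obtain t where t: "0 \<le> t" "(1 - t) *\<^sub>R p + t *\<^sub>R b \<in> interior S"
      by (auto simp: closed_segment_def)
    let ?x = "(1 - t) *\<^sub>R p + t *\<^sub>R b"
    have "?x - p = t *\<^sub>R (b - p)" by (simp add: algebra_simps)
    then have "?x - p = (t * norm (b - p)) *\<^sub>R w" using pa(2) by (metis scaleR_scaleR)
    moreover have "0 \<le> (?x - p) \<bullet> (u - w)" using t(2) interior_subset by (intro first_order) auto
    ultimately have "0 \<le> t * norm (b - p) * (w \<bullet> (u - w))" by (metis inner_scaleR_left)
    moreover have "w \<bullet> (u - w) < 0" using u1w by (simp add: inner_diff_right uu inner_commute)
    moreover have "0 < norm (b - p)" using ne by simp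
    ultimately have "t = 0" using t(1) by (smt (verit) mult_pos_pos mult_less_0_iff)
    then show False using t(2) not_int by simp
  qed
  show "closed_segment a p \<inter> interior S = {}"
  proof (rule ccontr)
    assume "closed_segment a p \<inter> interior S \<noteq> {}"
    then have "closed_segment p a \<inter> interior S \<noteq> {}" by (simp add: closed_segment_commute)
    then obtain t where t: "0 \<le> t" "(1 - t) *\<^sub>R p + t *\<^sub>R a \<in> interior S"
      by (auto simp: closed_segment_def)
    let ?x = "(1 - t) *\<^sub>R p + t *\<^sub>R a"
    have "?x - p = (- t) *\<^sub>R (p - a)" by (simp add: algebra_simps)
    then have "?x - p = (- t * norm (p - a)) *\<^sub>R u" using pa(1) by (metis scaleR_scaleR)
    moreover have "0 \<le> (?x - p) \<bullet> (u - w)" using t(2) interior_subset by (intro first_order) auto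
    ultimately have "0 \<le> - t * norm (p - a) * (u \<bullet> (u - w))" by (metis inner_scaleR_left)
    moreover have "0 < u \<bullet> (u - w)" using u1w by (simp add: inner_diff_right uu)
    moreover have "0 < norm (p - a)" using ne by simp
    ultimately have "t = 0" using t(1) by (smt (verit) mult_pos_pos mult_less_0_iff mult_minus_left)
    then show False using t(2) not_int by simp
  qed
qed

lemma closest_point_on_frontier:
  fixes S :: "'a::euclidean_space set"
  assumes "p \<in> S" "p \<noteq> b" and least: "\<And>x. x \<in> S \<Longrightarrow> dist p b \<le> dist x b"
  shows "p \<in> frontier S" "closed_segment p b \<inter> interior S = {}"
proof -
  have step: False if "0 < t" "t \<le> 1" "(1 - t) *\<^sub>R p + t *\<^sub>R b \<in> S" for t
  proof -
    have "(1 - t) *\<^sub>R p + t *\<^sub>R b - b = (1 - t) *\<^sub>R (p - b)" by (simp add: algebra_simps)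
    then have "dist ((1 - t) *\<^sub>R p + t *\<^sub>R b) b = (1 - t) * dist p b" using that by (simp add: dist_norm)
    then have "dist p b \<le> (1 - t) * dist p b" using least[OF that(3)] by metis
    then show False using that(1) assms(2) by (simp add: algebra_simps mult_le_0_iff)
  qed
  have not_int: "p \<notin> interior S"
  proof
    assume "p \<in> interior S"
    then obtain \<epsilon> where eps: "\<epsilon> > 0" "cball p \<epsilon> \<subseteq> S" by (meson mem_interior_cball)
    define t where "t = min 1 (\<epsilon> / dist p b)"
    have t: "0 < t" "t \<le> 1" using eps assms(2) by (auto simp: t_def)
    have "(1 - t) *\<^sub>R p + t *\<^sub>R b - p = t *\<^sub>R (b - p)" by (simp add: algebra_simps)
    then have "dist p ((1 - t) *\<^sub>R p + t *\<^sub>R b) = t * dist p b" 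
      using t by (metis abs_of_pos dist_commute dist_norm norm_scaleR)
    also have "\<dots> \<le> \<epsilon> / dist p b * dist p b" by (intro mult_right_mono) (auto simp: t_def)
    also have "\<dots> = \<epsilon>" using assms(2) by simp
    finally show False using step[OF t] eps by auto
  qed
  then show "p \<in> frontier S" using assms(1) closure_subset by (auto simp: frontier_def)
  show "closed_segment p b \<inter> interior S = {}"
  proof (rule ccontr)
    assume "closed_segment p b \<inter> interior S \<noteq> {}"
    then obtain t where t: "0 \<le> t" "t \<le> 1" "(1 - t) *\<^sub>R p + t *\<^sub>R b \<in> interior S"
      by (auto simp: closed_segment_def)
    then have "t = 0" using step[of t] interior_subset by fastforce
    then show False using t(3) not_int by simp
  qed
qed

text \<open>The vertices range over the whole obstacles, which makes the problem compact and convex.\<close>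

definition shortest_path :: "(real ^ 'm) set \<Rightarrow> nat \<Rightarrow> (nat \<Rightarrow> int ^ 'm) \<Rightarrow> (nat \<Rightarrow> real ^ 'm) \<Rightarrow> bool" where
  "shortest_path K s k p \<longleftrightarrow> (\<forall>i\<le>s. p i \<in> lift K (k i)) \<and>
     (\<forall>q. (\<forall>i\<le>s. q i \<in> lift K (k i)) \<longrightarrow> piece_length s p \<le> piece_length s q)"

lemma ex_shortest_path:
  assumes "compact K" "K \<noteq> {}"
  obtains p where "shortest_path K s k p"
proof -
  define S where "S = PiE UNIV (\<lambda>i. lift K (k i))"
  have ne: "lift K (k i) \<noteq> {}" for i using assms(2) by (simp add: lift_def)
  have cp: "compact (lift K (k i))" for i
    unfolding lift_def using assms(1) by (intro compact_continuous_image continuous_intros)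
  have "compactin (product_topology (\<lambda>i. euclidean) UNIV) S"
    unfolding S_def compactin_PiE using cp by simp
  then have "compact S" by (simp add: euclidean_product_topology)
  moreover have "S \<noteq> {}" using ne by (simp add: S_def PiE_eq_empty_iff)
  moreover have "continuous_on S (piece_length s)" unfolding piece_length_def
    by (intro continuous_intros continuous_on_subset[OF continuous_on_product_coordinates]) auto
  ultimately obtain p where p: "p \<in> S" "\<And>q. q \<in> S \<Longrightarrow> piece_length s p \<le> piece_length s q"
    using continuous_attains_inf[of S "piece_length s"] by blast
  have "shortest_path K s k p" unfolding shortest_path_def
  proof (intro conjI allI impI)
    show "p i \<in> lift K (k i)" for i using p(1) by (auto simp: S_def)
    fix q assume q: "\<forall>i\<le>s. q i \<in> lift K (k i)"
    define q' where "q' i = (if i \<le> s then q i else p i)" for i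
    have "q' \<in> S" using q p(1) by (auto simp: S_def q'_def)
    moreover have "piece_length s q' = piece_length s q" 
      unfolding piece_length_def by (intro sum.cong) (auto simp: q'_def)
    ultimately show "piece_length s p \<le> piece_length s q" using p(2) by metis
  qed
  then show thesis by (rule that)
qed

lemma shortest_path_vary_vertex:
  assumes "shortest_path K s k p" "i \<le> s" "x \<in> lift K (k i)"
  shows "(\<Sum>j | j < s \<and> (j = i \<or> Suc j = i). dist (p j) (p (Suc j)))
    \<le> (\<Sum>j | j < s \<and> (j = i \<or> Suc j = i). dist ((p(i := x)) j) ((p(i := x)) (Suc j)))"
proof -
  let ?A = "{j. j < s \<and> (j = i \<or> Suc j = i)}"
  have split: "piece_length s q = (\<Sum>j\<in>?A. dist (q j) (q (Suc j))) + (\<Sum>j\<in>{..<s} - ?A. dist (q j) (q (Suc j)))" for q :: "nat \<Rightarrow> real ^ 'a"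
    unfolding piece_length_def by (subst add.commute, rule sum.subset_diff) auto
  have "(\<Sum>j\<in>{..<s} - ?A. dist ((p(i := x)) j) ((p(i := x)) (Suc j))) = (\<Sum>j\<in>{..<s} - ?A. dist (p j) (p (Suc j)))"
    by (intro sum.cong) auto
  moreover have "piece_length s p \<le> piece_length s (p(i := x))"
    using assms by (auto simp: shortest_path_def)
  ultimately show ?thesis unfolding split by linarith
qed

text \<open>The fourth condition of admissibility is what \<open>reflection_at_shortest\<close> needs at inner
  vertices; the third one keeps each side away from the obstacles not at its ends, because the side
  lies in the convex hull of the two obstacles that it joins.\<close>

theorem shortest_path_is_trajectory:
  assumes K: "torus_obstacle K" and k: "admissible K s k" and "0 < s" and p: "shortest_path K s k p"
  shows "trajectory_piece K s k p"
proof -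
  have disj: "lift K i \<inter> lift K j = {}" if "i \<noteq> j" for i j using K that by (auto simp: torus_obstacle_def)
  have conv: "convex (lift K i)" for i
    using K unfolding lift_def torus_obstacle_def strictly_convex_def
    by (metis (no_types, lifting) add.commute convex_translation image_cong)
  have mem: "p i \<in> lift K (k i)" if "i \<le> s" for i using p that by (auto simp: shortest_path_def)
  have kne: "k (Suc i) \<noteq> k i" if "i < s" for i using k that by (auto simp: admissible_def)
  have pne: "p i \<noteq> p (Suc i)" if "i < s" for i
    using disj[OF kne[OF that]] mem[of i] mem[of "Suc i"] that by (auto simp: disjoint_iff)
  have hull: "closed_segment (p i) (p j) \<subseteq> convex hull (lift K (k i) \<union> lift K (k j))" if "i \<le> s" "j \<le> s" for i j
    by (rule closed_segment_subset_convex_hull) (use mem that in \<open>auto intro: hull_inc\<close>)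
  have inner: "p (Suc i) \<in> frontier (lift K (k (Suc i))) \<and>
      reflects (lift K (k (Suc i))) (p (Suc i)) (sgn (p (Suc i) - p i)) (sgn (p (Suc (Suc i)) - p (Suc i))) \<and>
      closed_segment (p i) (p (Suc i)) \<inter> interior (lift K (k (Suc i))) = {} \<and>
      closed_segment (p (Suc i)) (p (Suc (Suc i))) \<inter> interior (lift K (k (Suc i))) = {}"
    if i: "Suc i < s" for i
  proof -
    have nseg: "p (Suc i) \<notin> closed_segment (p i) (p (Suc (Suc i)))"
    proof
      assume "p (Suc i) \<in> closed_segment (p i) (p (Suc (Suc i)))"
      then have "p (Suc i) \<in> convex hull (lift K (k i) \<union> lift K (k (Suc (Suc i))))"
        using hull[of i "Suc (Suc i)"] i by auto
      then have "between K (k (Suc i)) (k i) (k (Suc (Suc i)))"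
        using mem[of "Suc i"] kne[of i] kne[of "Suc i"] i by (auto simp: between_def)
      then show False using k i by (auto simp: admissible_def)
    qed
    have least: "dist (p i) (p (Suc i)) + dist (p (Suc i)) (p (Suc (Suc i)))
        \<le> dist (p i) x + dist x (p (Suc (Suc i)))" if "x \<in> lift K (k (Suc i))" for x
    proof -
      have "{j. j < s \<and> (j = Suc i \<or> Suc j = Suc i)} = {i, Suc i}" using i by auto
      then show ?thesis using shortest_path_vary_vertex[OF p _ that] i by simp
    qed
    show ?thesis using reflection_at_shortest[OF conv mem nseg least] i by simp
  qed
  have first: "p 0 \<in> frontier (lift K (k 0)) \<and> closed_segment (p 0) (p 1) \<inter> interior (lift K (k 0)) = {}"
  proof -
    have least: "dist (p 0) (p 1) \<le> dist x (p 1)" if "x \<in> lift K (k 0)" for x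
    proof -
      have "{j. j < s \<and> (j = 0 \<or> Suc j = 0)} = {0}" using \<open>0 < s\<close> by auto
      then show ?thesis using shortest_path_vary_vertex[OF p _ that] by simp
    qed
    show ?thesis using closest_point_on_frontier[OF mem _ least] pne[of 0] \<open>0 < s\<close> by simp
  qed
  have last: "p s \<in> frontier (lift K (k s)) \<and> closed_segment (p (s - 1)) (p s) \<inter> interior (lift K (k s)) = {}"
  proof -
    have least: "dist (p s) (p (s - 1)) \<le> dist x (p (s - 1))" if "x \<in> lift K (k s)" for x
    proof -
      have "{j. j < s \<and> (j = s \<or> Suc j = s)} = {s - 1}" using \<open>0 < s\<close> by auto
      then show ?thesis using shortest_path_vary_vertex[OF p _ that] \<open>0 < s\<close>
        by (cases s) (simp_all add: dist_commute)
    qed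
    show ?thesis using closest_point_on_frontier[OF mem _ least] pne[of "s - 1"] \<open>0 < s\<close>
      by (simp add: closed_segment_commute)
  qed
  show ?thesis unfolding trajectory_piece_def
  proof (intro conjI allI impI)
    fix i assume "i \<le> s"
    then consider "i = 0" | "i = s" | i' where "i = Suc i'" "Suc i' < s" by (cases i) (auto simp: order_le_less)
    then show "p i \<in> frontier (lift K (k i))" using first last inner by cases auto
  next
    fix i j assume i: "i < s"
    show "closed_segment (p i) (p (Suc i)) \<inter> interior (lift K j) = {}"
    proof -
      consider "j = k i" | "j = k (Suc i)" | "j \<noteq> k i" "j \<noteq> k (Suc i)" by blast
      then show ?thesis
      proof cases
        case 1
        then show ?thesis using first inner[of "i - 1"] i by (cases i) auto
      next
        case 2
        then show ?thesis using last inner[of i] i by (cases "Suc i = s") auto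
      next
        case 3
        have "\<not> between K j (k i) (k (Suc i))" using k i by (auto simp: admissible_def)
        then show ?thesis using 3 hull[of i "Suc i"] i interior_subset[of "lift K j"] by (auto simp: between_def)
      qed
    qed
  qed (use \<open>0 < s\<close> pne inner in auto)
qed

section \<open>Admissibility from steps\<close>

lemma between_imp_near_segment:
  assumes "K \<subseteq> cball c r" "between K l i j"
  obtains t where "0 \<le> t" "t \<le> 1" "norm (of_int_vec (l - i) - t *\<^sub>R of_int_vec (j - i)) \<le> 2 * r"
proof -
  define Z where "Z = (\<Union>x\<in>closed_segment (c + of_int_vec i) (c + of_int_vec j). \<Union>y\<in>cball 0 r. {x + y})"
  have "convex Z" unfolding Z_def by (intro convex_sums) auto
  moreover have "lift K i \<subseteq> Z" "lift K j \<subseteq> Z"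
  proof -
    have "x + of_int_vec n \<in> Z" if "x \<in> K" "n = i \<or> n = j" for x n
    proof -
      have "x - c \<in> cball 0 r" using assms(1) that(1) by (auto simp: dist_norm norm_minus_commute)
      moreover have "c + of_int_vec n \<in> closed_segment (c + of_int_vec i) (c + of_int_vec j)" using that(2) by auto
      moreover have "x + of_int_vec n = (c + of_int_vec n) + (x - c)" by simp
      ultimately show ?thesis unfolding Z_def by blast
    qed
    then show "lift K i \<subseteq> Z" "lift K j \<subseteq> Z" by (auto simp: lift_def)
  qed
  ultimately have "convex hull (lift K i \<union> lift K j) \<subseteq> Z" by (intro hull_minimal) auto
  then obtain y where y: "y \<in> lift K l" "y \<in> Z" using assms(2) by (auto simp: between_def)
  obtain z where z: "z \<in> K" "y = z + of_int_vec l" using y(1) by (auto simp: lift_def)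
  obtain t b where t: "0 \<le> t" "t \<le> 1" "norm b \<le> r"
      "y = (1 - t) *\<^sub>R (c + of_int_vec i) + t *\<^sub>R (c + of_int_vec j) + b"
    using y(2) by (auto simp: Z_def closed_segment_def)
  have "norm (c - z) \<le> r" using assms(1) z(1) by (auto simp: dist_norm)
  moreover have "of_int_vec (l - i) - t *\<^sub>R of_int_vec (j - i) = (c - z) + b"
    using z(2) t(4) by (simp add: algebra_simps)
  ultimately have "norm (of_int_vec (l - i) - t *\<^sub>R of_int_vec (j - i)) \<le> 2 * r"
    using norm_triangle_ineq[of "c - z" b] t(3) by simp
  then show thesis using that t by blast
qed

lemma isolated_step_not_between:
  assumes "K \<subseteq> cball c r" "isolated_step (2 * r) (j - i)"
  shows "\<not> between K l i j"
proof
  assume b: "between K l i j"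
  from between_imp_near_segment[OF assms(1) b] have "l - i = 0 \<or> l - i = j - i"
    using assms(2) unfolding isolated_step_def by metis
  then show False using b by (auto simp: between_def)
qed

lemma turning_not_between:
  assumes "K \<subseteq> cball c r" "turning (2 * r) (l - i) (j - l)"
  shows "\<not> between K l i j"
proof
  assume b: "between K l i j"
  obtain t where "0 \<le> t" "t \<le> 1" "norm (of_int_vec (l - i) - t *\<^sub>R of_int_vec (j - i)) \<le> 2 * r"
    by (rule between_imp_near_segment[OF assms(1) b])
  moreover have "j - i = (l - i) + (j - l)" by simp
  ultimately show False using assms(2) unfolding turning_def by (metis not_le)
qed

section \<open>Tracking a velocity\<close>

locale small_obstacle = short_vector_gap r N dim
  for r :: real and N :: nat and dim :: "'m::finite itself" +
  fixes K :: "(real ^ 'm) set" and c :: "real ^ 'm"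
  assumes K: "torus_obstacle K" and K_ball: "K \<subseteq> cball c r"
begin

text \<open>These unit vectors serve as turns between long steps.\<close>

definition signed_axes :: "(int ^ 'm) set" where
  "signed_axes = {axis i s | i s. \<bar>s\<bar> = 1}"

lemma signed_axes_norm: "a \<in> signed_axes \<Longrightarrow> norm (V a) = 1"
  by (auto simp: signed_axes_def of_int_vec_axis norm_eq_1 inner_axis_axis abs_if split: if_splits)

lemma signed_axesI: "\<bar>s\<bar> = 1 \<Longrightarrow> axis i s \<in> signed_axes"
  by (auto simp: signed_axes_def)

lemma signed_axes_ne: "signed_axes \<noteq> {}"
  using signed_axesI[of 1] by auto

lemma signed_axis_isolated:
  assumes a: "a \<in> signed_axes"
  shows "isolated_step (2 * r) a"
  unfolding isolated_step_def
proof (intro conjI allI impI, rule_tac [2] ccontr)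
  show a0: "a \<noteq> 0" using signed_axes_norm[OF a] by auto
  fix l and t :: real
  assume t: "0 \<le> t" "t \<le> 1" and l: "norm (V l - t *\<^sub>R V a) \<le> 2 * r" and "\<not> (l = 0 \<or> l = a)"
  then have l0: "l \<noteq> 0" "a - l \<noteq> 0" by auto
  define q where "q = V l - t *\<^sub>R V a"
  have q: "V l = t *\<^sub>R V a + q" by (simp add: q_def)
  have "1 \<le> (norm (V a))\<^sup>2 / 4 + (norm q)\<^sup>2"
  proof (rule convex_split_bound[OF t])
    show "1 \<le> (norm (t *\<^sub>R V a + q))\<^sup>2" using norm_of_int_vec_ge_1[OF l0(1)] unfolding q[symmetric] by simp
    show "1 \<le> (norm (V a - (t *\<^sub>R V a + q)))\<^sup>2"
      using norm_of_int_vec_ge_1[OF l0(2)] unfolding q[symmetric] by simp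
  qed
  moreover have "(norm q)\<^sup>2 \<le> (2 * r)\<^sup>2" using l unfolding q_def by (intro power_mono) auto
  ultimately show False using r_sq by (simp add: signed_axes_norm[OF a] power_mult_distrib)
qed

lemma signed_axes_turning:
  assumes "a \<in> signed_axes" "b \<in> signed_axes" "a \<noteq> b"
  shows "turning (2 * r) a b"
proof (cases "b = - a")
  case True
  then show ?thesis using signed_axes_norm[OF assms(1)] r_small r_pos by (simp add: turning_def)
next
  case False
  obtain i s j t where ab: "a = axis i s" "\<bar>s\<bar> = 1" "b = axis j t" "\<bar>t\<bar> = 1"
    using assms by (auto simp: signed_axes_def)
  have "i \<noteq> j"
  proof
    assume "i = j"
    then have "s = t \<or> s = - t" using ab by (auto simp: abs_if split: if_splits)
    moreover have "axis j (- t) = - axis j t" by (simp add: axis_def vec_eq_iff)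
    ultimately show False using assms(3) False ab \<open>i = j\<close> by auto
  qed
  then have o: "V a \<bullet> V b = 0" by (simp add: ab of_int_vec_axis inner_axis_axis)
  have n: "V a \<bullet> V a = 1" "V b \<bullet> V b = 1"
    using signed_axes_norm[OF assms(1)] signed_axes_norm[OF assms(2)] by (simp_all add: norm_eq_1)
  show ?thesis
  proof (rule turning_if_gram)
    have "(norm (V (a + b)))\<^sup>2 = 2"
      by (simp add: power2_norm_eq_inner inner_add_left inner_add_right n o inner_commute[of "V b" "V a"])
    then show "(2 * r)\<^sup>2 * (norm (V (a + b)))\<^sup>2 < gram (V a) (V b)"
      using r_sq r_pos by (simp add: gram_def n o power_mult_distrib)
  qed
qed

lemma turning_long_axis:
  assumes "a \<in> signed_axes" "1 \<le> norm (V v)" "(V v \<bullet> V a)\<^sup>2 \<le> (V v \<bullet> V v) / 2"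
  shows "turning (2 * r) v a" "turning (2 * r) a v"
proof -
  have n: "V a \<bullet> V a = 1" using signed_axes_norm[OF assms(1)] by (simp add: norm_eq_1)
  have g: "(norm (V v))\<^sup>2 / 2 \<le> gram (V v) (V a)"
    using assms(3) by (simp add: gram_def n power2_norm_eq_inner)
  have "norm (V v + V a) \<le> 2 * norm (V v)"
    using norm_triangle_ineq[of "V v" "V a"] signed_axes_norm[OF assms(1)] assms(2) by simp
  then have "(norm (V v + V a))\<^sup>2 \<le> (2 * norm (V v))\<^sup>2" by (intro power_mono) auto
  then have "(2 * r)\<^sup>2 * (norm (V v + V a))\<^sup>2 \<le> (2 * r)\<^sup>2 * (2 * norm (V v))\<^sup>2"
    by (intro mult_left_mono) auto
  also have "\<dots> = 16 * r\<^sup>2 * (norm (V v))\<^sup>2" by (simp add: power_mult_distrib)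
  also have "\<dots> < 1/2 * (norm (V v))\<^sup>2"
    using r_sq assms(2) by (intro mult_strict_right_mono zero_less_power) auto
  finally have lt: "(2 * r)\<^sup>2 * (norm (V v + V a))\<^sup>2 < gram (V v) (V a)" using g by simp
  show "turning (2 * r) v a" using lt by (intro turning_if_gram) simp
  show "turning (2 * r) a v" using lt by (intro turning_if_gram) (simp add: gram_commute add.commute)
qed

definition shortest_length :: "nat \<Rightarrow> (nat \<Rightarrow> int ^ 'm) \<Rightarrow> real" where
  "shortest_length s k = piece_length s (SOME p. shortest_path K s k p)"

lemma shortest_length: 
  obtains p where "shortest_path K s k p" "piece_length s p = shortest_length s k"
proof -
  have "K \<noteq> {}" "compact K" using K by (auto simp: torus_obstacle_def)
  then obtain p where "shortest_path K s k p" using ex_shortest_path by blast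
  then have "shortest_path K s k (SOME p. shortest_path K s k p)" by (rule someI[of "shortest_path K s k"])
  then show thesis using that by (simp add: shortest_length_def)
qed

lemma shortest_length_le:
  assumes "\<forall>i\<le>s. q i \<in> lift K (k i)"
  shows "shortest_length s k \<le> piece_length s q"
proof -
  obtain p where "shortest_path K s k p" "piece_length s p = shortest_length s k"
    by (rule shortest_length)
  then show ?thesis using assms by (auto simp: shortest_path_def)
qed

lemma lift_diff:
  assumes "p \<in> lift K i" "q \<in> lift K j"
  shows "norm ((q - p) - V (j - i)) \<le> 2 * r"
proof -
  obtain x y where xy: "x \<in> K" "y \<in> K" "p = x + V i" "q = y + V j"
    using assms by (auto simp: lift_def)
  have "(q - p) - V (j - i) = (y - c) + (c - x)" by (simp add: xy)
  moreover have "norm (y - c) \<le> r" "norm (c - x) \<le> r" 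
    using K_ball xy by (auto simp: dist_norm norm_minus_commute)
  ultimately show ?thesis using norm_triangle_ineq[of "y - c" "c - x"] by simp
qed

text \<open>Some admissible type of \<open>s\<close> steps ends at the obstacle \<open>x\<close> with the last step \<open>a\<close> and has
  minimal length \<open>L\<close>. Nothing else about a type matters for its continuation.\<close>

definition reaches :: "nat \<Rightarrow> int ^ 'm \<Rightarrow> int ^ 'm \<Rightarrow> real \<Rightarrow> bool" where
  "reaches s x a L \<longleftrightarrow> (\<exists>k. admissible K s k \<and> 0 < s \<and> k s = x \<and> k s - k (s - 1) = a \<and>
     shortest_length s k = L)"

lemma reaches_first:
  assumes "isolated_step (2 * r) a"
  shows "\<exists>L. 0 \<le> L \<and> reaches 1 a a L"
proof -
  define k where "k i = (if i = 0 then 0 else a)" for i :: nat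
  have a: "a \<noteq> 0" using assms by (simp add: isolated_step_def)
  have "\<not> between K l 0 a" for l
    by (rule isolated_step_not_between[OF K_ball]) (use assms in simp)
  then have "admissible K 1 k" using a by (auto simp: admissible_def k_def)
  moreover have "0 \<le> shortest_length 1 k"
    unfolding shortest_length_def piece_length_def by (simp add: sum_nonneg)
  ultimately show ?thesis unfolding reaches_def
    by (intro exI[of _ "shortest_length 1 k"] conjI exI[of _ k]) (auto simp: k_def)
qed

text \<open>The upper bound continues a shortest path by a translation of its end by \<open>b\<close>. The lower
  bound drops the last side of a shortest path of the longer type; that side has length at least
  \<open>norm b - 2 * r\<close>.\<close>

lemma reaches_step:
  assumes "reaches s x a L" "isolated_step (2 * r) b" "turning (2 * r) a b"
  obtains L' where "reaches (Suc s) (x + b) b L'" "L + (1 - 2 * r) \<le> L'" "L' \<le> L + norm (V b)"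
proof -
  obtain k where k: "admissible K s k" "0 < s" "k s = x" "k s - k (s - 1) = a" "shortest_length s k = L"
    using assms(1) by (auto simp: reaches_def)
  define k' where "k' = k(Suc s := x + b)"
  have b0: "b \<noteq> 0" using assms(2) by (simp add: isolated_step_def)
  have nb1: "\<not> between K l x (x + b)" for l
    by (rule isolated_step_not_between[OF K_ball]) (use assms(2) in simp)
  have nb2: "\<not> between K x (k (s - 1)) (x + b)"
    by (rule turning_not_between[OF K_ball]) (use assms(3) k(3,4) in auto)
  have "admissible K (Suc s) k'" unfolding admissible_def
  proof (intro conjI allI impI)
    show "k' 0 = 0" using k(1) by (simp add: k'_def admissible_def)
    show "k' (Suc n) \<noteq> k' n" if "n < Suc s" for n
      using that k b0 by (cases "n = s") (auto simp: k'_def admissible_def)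
    show "\<not> (\<exists>l. between K l (k' n) (k' (Suc n)))" if "n < Suc s" for n
      using that k nb1 by (cases "n = s") (auto simp: k'_def admissible_def)
    show "\<not> between K (k' (Suc n)) (k' n) (k' (Suc (Suc n)))" if "Suc n < Suc s" for n
      using that k nb2 by (cases "Suc n = s") (auto simp: k'_def admissible_def)
  qed
  then have r': "reaches (Suc s) (x + b) b (shortest_length (Suc s) k')"
    unfolding reaches_def using k(3) by (intro exI[of _ k']) (simp add: k'_def)
  obtain p where p: "shortest_path K s k p" "piece_length s p = L"
    using shortest_length k(5) by metis
  have pm: "p i \<in> lift K (k i)" if "i \<le> s" for i using p(1) that by (auto simp: shortest_path_def)
  define p' where "p' = p(Suc s := p s + V b)"
  have "p s + V b \<in> lift K (x + b)" using pm[of s] k(3) by (auto simp: lift_def algebra_simps)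
  then have "\<forall>i\<le>Suc s. p' i \<in> lift K (k' i)" using pm by (auto simp: p'_def k'_def le_Suc_eq)
  then have "shortest_length (Suc s) k' \<le> piece_length (Suc s) p'" by (rule shortest_length_le)
  also have "\<dots> = L + norm (V b)" 
    using p(2) by (simp add: piece_length_def p'_def dist_norm)
  finally have up: "shortest_length (Suc s) k' \<le> L + norm (V b)" .
  obtain q where q: "shortest_path K (Suc s) k' q" "piece_length (Suc s) q = shortest_length (Suc s) k'"
    by (rule shortest_length)
  have qm: "q i \<in> lift K (k' i)" if "i \<le> Suc s" for i using q(1) that by (auto simp: shortest_path_def)
  have "\<forall>i\<le>s. q i \<in> lift K (k i)" using qm by (metis fun_upd_other k'_def le_Suc_eq n_not_Suc_n not_less_eq_eq)
  then have "L \<le> piece_length s q" using shortest_length_le k(5) by metis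
  moreover have "1 - 2 * r \<le> dist (q s) (q (Suc s))"
  proof -
    have "norm ((q (Suc s) - q s) - V (x + b - x)) \<le> 2 * r"
      using qm[of s] qm[of "Suc s"] k(3) by (intro lift_diff) (auto simp: k'_def)
    then have "norm (V b) \<le> norm (q (Suc s) - q s) + 2 * r"
      using norm_triangle_ineq2[of "V b" "q (Suc s) - q s"] by (simp add: norm_minus_commute)
    then show ?thesis using norm_of_int_vec_ge_1[OF b0] by (simp add: dist_norm norm_minus_commute)
  qed
  ultimately have "L + (1 - 2 * r) \<le> piece_length (Suc s) q" by (simp add: piece_length_def)
  then show thesis using that[OF r'] up q(2) by simp
qed

definition speed :: real where "speed = (real N - 1) / (real N + 1)"

lemma speed_nonneg: "0 \<le> speed" and speed_le_1: "speed \<le> 1"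
  using N by (auto simp: speed_def)

text \<open>A block consists of a step of norm \<open>x\<close> and at most two unit steps. Since
  \<open>x / (x + 2)\<close> increases, the case \<open>x = N\<close> decides: there
  \<open>37 * r\<^sup>2 * N * (N + 1) \<le> 2\<close> is required, which follows from \<open>radius\<close> and \<open>N \<le> 2 * (N - 1)\<close>.\<close>

lemma speed_bound:
  assumes "real N \<le> x"
  shows "speed * (x + 2) \<le> (1 - 37 * r\<^sup>2) * x"
proof -
  have r2: "0 \<le> r\<^sup>2" by simp
  have N2: "2 \<le> real N" using N by simp
  have "37 * r\<^sup>2 * (real N * (real N + 1)) \<le> 37 * r\<^sup>2 * (2 * ((real N - 1) * (real N + 1)))"
  proof (intro mult_left_mono)
    have "real N * (real N + 1) \<le> (2 * (real N - 1)) * (real N + 1)" using N2 by (intro mult_right_mono) auto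
    then show "real N * (real N + 1) \<le> 2 * ((real N - 1) * (real N + 1))" by simp
  qed auto
  also have "\<dots> = 74 * (r\<^sup>2 * ((real N)\<^sup>2 - 1))" by (simp add: power2_eq_square algebra_simps)
  also have "\<dots> \<le> 2" using radius by simp
  finally have b: "37 * r\<^sup>2 * (real N + 1) * real N \<le> 2" by (simp add: algebra_simps)
  have b': "37 * r\<^sup>2 * (real N + 1) \<le> 1"
  proof -
    have "37 * r\<^sup>2 * (real N + 1) * 2 \<le> 37 * r\<^sup>2 * (real N + 1) * real N" using N2 by (intro mult_left_mono) auto
    from order_trans[OF this b] show ?thesis by (simp add: mult_ac)
  qed
  have "(real N - 1) * 2 \<le> real N * (2 - 37 * r\<^sup>2 * (real N + 1))" using b by (simp add: algebra_simps)
  also have "\<dots> \<le> x * (2 - 37 * r\<^sup>2 * (real N + 1))" using assms b' by (intro mult_right_mono) auto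
  finally have "(real N - 1) * (x + 2) \<le> (1 - 37 * r\<^sup>2) * x * (real N + 1)" by (simp add: algebra_simps)
  then have "(real N - 1) * (x + 2) / (real N + 1) \<le> (1 - 37 * r\<^sup>2) * x" by (simp add: pos_divide_le_eq)
  then show ?thesis by (simp add: speed_def)
qed

text \<open>The block is \<open>b\<close>, \<open>v\<close>, \<open>b\<close> with a long isolated step \<open>v\<close> near the direction \<open>e\<close> and a
  signed axis \<open>b\<close> for which the coordinate of \<open>v\<close> is small and that of \<open>e\<close> is not negative. If the
  preceding step is already \<open>b\<close>, the first \<open>b\<close> is left out, since two equal steps would put
  an obstacle between its neighbours.\<close>

lemma reaches_block:
  "\<exists>M. \<forall>s x a L e. reaches s x a L \<longrightarrow> a \<in> signed_axes \<longrightarrow> norm e = 1 \<longrightarrow>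
     (\<exists>s' d a' L'. reaches s' (x + d) a' L' \<and> a' \<in> signed_axes \<and> L + (1 - 2 * r) \<le> L' \<and>
        L' - L \<le> M \<and> norm (V d) \<le> M \<and> speed * (L' - L) \<le> V d \<bullet> e)"
proof -
  obtain M where M: "\<And>e :: real ^ 'm. norm e = 1 \<Longrightarrow> \<exists>v. isolated_step (2 * r) v \<and> real N \<le> norm (V v) \<and>
     norm (V v) \<le> M \<and> (1 - 37 * r\<^sup>2) * norm (V v) \<le> V v \<bullet> e"
    using long_isolated_vector by blast
  have "\<exists>s' d a' L'. reaches s' (x + d) a' L' \<and> a' \<in> signed_axes \<and> L + (1 - 2 * r) \<le> L' \<and>
        L' - L \<le> M + 2 \<and> norm (V d) \<le> M + 2 \<and> speed * (L' - L) \<le> V d \<bullet> e"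
    if start: "reaches s x a L" "a \<in> signed_axes" and e: "norm e = 1" for s x a L e
  proof -
    obtain v where v: "isolated_step (2 * r) v" "real N \<le> norm (V v)" "norm (V v) \<le> M"
      "(1 - 37 * r\<^sup>2) * norm (V v) \<le> V v \<bullet> e" using M[OF e] by blast
    obtain i where i: "((V v) $ i)\<^sup>2 \<le> (V v \<bullet> V v) / 2" by (rule ex_small_coordinate[OF two_dims])
    define b where "b = axis i (if 0 \<le> e $ i then 1 else - 1 :: int)"
    have b: "b \<in> signed_axes" by (simp add: b_def signed_axesI)
    have be: "0 \<le> V b \<bullet> e" by (simp add: b_def of_int_vec_axis inner_axis')
    have vb: "(V v \<bullet> V b)\<^sup>2 \<le> (V v \<bullet> V v) / 2" using i by (simp add: b_def of_int_vec_axis inner_axis)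
    have v1: "1 \<le> norm (V v)" using v(2) N by simp
    note turn = turning_long_axis[OF b v1 vb]
    have nb: "norm (V b) = 1" by (rule signed_axes_norm[OF b])
    have r1: "0 \<le> 1 - 2 * r" using r_small r_pos by simp
    have gain: "speed * (norm (V v) + 2) \<le> V v \<bullet> e" using speed_bound[OF v(2)] v(4) by simp
    have "\<exists>s1 d1 L1. reaches s1 (x + d1) b L1 \<and> L \<le> L1 \<and> L1 \<le> L + 1 \<and> norm (V d1) \<le> 1 \<and> 0 \<le> V d1 \<bullet> e"
    proof (cases "a = b")
      case True
      then show ?thesis using start by (intro exI[of _ s] exI[of _ 0] exI[of _ L]) auto
    next
      case False
      obtain L1 where "reaches (Suc s) (x + b) b L1" "L + (1 - 2 * r) \<le> L1" "L1 \<le> L + norm (V b)"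
        by (rule reaches_step[OF start(1) signed_axis_isolated[OF b] signed_axes_turning[OF start(2) b False]])
      then show ?thesis using nb be r1 by (intro exI[of _ "Suc s"] exI[of _ b] exI[of _ L1]) auto
    qed
    then obtain s1 d1 L1 where 1: "reaches s1 (x + d1) b L1" "L \<le> L1" "L1 \<le> L + 1" "norm (V d1) \<le> 1" "0 \<le> V d1 \<bullet> e"
      by blast
    obtain L2 where 2: "reaches (Suc s1) (x + d1 + v) v L2" "L1 + (1 - 2 * r) \<le> L2" "L2 \<le> L1 + norm (V v)"
      by (rule reaches_step[OF 1(1) v(1) turn(2)])
    obtain L3 where 3: "reaches (Suc (Suc s1)) (x + d1 + v + b) b L3" "L2 + (1 - 2 * r) \<le> L3" "L3 \<le> L2 + norm (V b)"
      by (rule reaches_step[OF 2(1) signed_axis_isolated[OF b] turn(1)])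
    define d where "d = d1 + v + b"
    have "speed * (L3 - L) \<le> speed * (norm (V v) + 2)"
      using 1 2 3 nb by (intro mult_left_mono speed_nonneg) auto
    also have "\<dots> \<le> V d \<bullet> e" using gain 1(5) be by (simp add: d_def inner_add_left)
    finally have "speed * (L3 - L) \<le> V d \<bullet> e" .
    moreover have "norm (V d) \<le> M + 2"
      using norm_triangle_ineq[of "V d1 + V v" "V b"] norm_triangle_ineq[of "V d1" "V v"] 1(4) v(3) nb
      by (simp add: d_def)
    moreover have "reaches (Suc (Suc s1)) (x + d) b L3" using 3(1) by (simp add: d_def add.assoc)
    ultimately show ?thesis using b 1 2 3 nb v(3) r1
      by (intro exI[of _ "Suc (Suc s1)"] exI[of _ d] exI[of _ b] exI[of _ L3]) auto
  qed
  then show ?thesis by blast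
qed

text \<open>Induction on \<open>n\<close> with the feedback rule: the direction \<open>e\<close> of the next block is that of the
  error \<open>E\<close>. Since \<open>norm w \<le> speed\<close>, the block moves ahead of \<open>w\<close> in this direction, so the
  change \<open>z\<close> of the error satisfies \<open>E \<bullet> z \<le> 0\<close>, and the squared error grows by at most
  \<open>(norm z)\<^sup>2 \<le> C\<close>.\<close>

lemma reaches_tracking:
  assumes w: "norm w \<le> speed"
  shows "\<exists>C>0. \<forall>n. \<exists>s x a L. reaches s x a L \<and> a \<in> signed_axes \<and> real n * (1 - 2 * r) \<le> L \<and>
     (norm (L *\<^sub>R w - V x))\<^sup>2 \<le> (real n + 1) * C"
proof -
  obtain M where M: "\<And>s x a L e. reaches s x a L \<Longrightarrow> a \<in> signed_axes \<Longrightarrow> norm e = 1 \<Longrightarrow>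
     \<exists>s' d a' L'. reaches s' (x + d) a' L' \<and> a' \<in> signed_axes \<and> L + (1 - 2 * r) \<le> L' \<and>
        L' - L \<le> M \<and> norm (V d) \<le> M \<and> speed * (L' - L) \<le> V d \<bullet> e"
    using reaches_block by blast
  have r1: "0 < 1 - 2 * r" using r_small r_pos by simp
  obtain a0 where a0: "a0 \<in> signed_axes" using signed_axes_ne by blast
  obtain L0 where L0: "0 \<le> L0" "reaches 1 a0 a0 L0" using reaches_first[OF signed_axis_isolated[OF a0]] by blast
  define C where "C = (norm (L0 *\<^sub>R w - V a0))\<^sup>2 + (2 * M)\<^sup>2 + 1"
  have C: "(norm (L0 *\<^sub>R w - V a0))\<^sup>2 \<le> C" "(2 * M)\<^sup>2 \<le> C" "0 < C" 
    by (auto simp: C_def add_nonneg_pos)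
  have "\<exists>s x a L. reaches s x a L \<and> a \<in> signed_axes \<and> real n * (1 - 2 * r) \<le> L \<and>
     (norm (L *\<^sub>R w - V x))\<^sup>2 \<le> (real n + 1) * C" for n
  proof (induction n)
    case 0
    show ?case using L0 a0 C by (intro exI[of _ 1] exI[of _ a0] exI[of _ L0]) auto
  next
    case (Suc n)
    then obtain s x a L where IH: "reaches s x a L" "a \<in> signed_axes" "real n * (1 - 2 * r) \<le> L"
      "(norm (L *\<^sub>R w - V x))\<^sup>2 \<le> (real n + 1) * C" by blast
    define E where "E = L *\<^sub>R w - V x"
    \<comment> \<open>If there is no error, any unit vector will do.\<close>
    define e where "e = (if E = 0 then V a0 else sgn E)"
    have e: "norm e = 1" using signed_axes_norm[OF a0] by (simp add: e_def norm_sgn)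
    have Ee: "E = norm E *\<^sub>R e" by (simp add: e_def sgn_div_norm)
    obtain s' d a' L' where st: "reaches s' (x + d) a' L'" "a' \<in> signed_axes" "L + (1 - 2 * r) \<le> L'"
        "L' - L \<le> M" "norm (V d) \<le> M" "speed * (L' - L) \<le> V d \<bullet> e"
      using M[OF IH(1,2) e] by blast
    define z where "z = (L' - L) *\<^sub>R w - V d"
    have L'L: "0 \<le> L' - L" using st(3) r1 by simp
    have E': "L' *\<^sub>R w - V (x + d) = E + z" by (simp add: E_def z_def algebra_simps)
    have "norm z \<le> norm ((L' - L) *\<^sub>R w) + norm (V d)" unfolding z_def by (rule norm_triangle_ineq4)
    also have "norm ((L' - L) *\<^sub>R w) = (L' - L) * norm w" using L'L by simp
    also have "\<dots> \<le> M * 1" using L'L st(4) w speed_le_1 by (intro mult_mono) auto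
    finally have "norm z \<le> 2 * M" using st(5) by simp
    then have z2: "(norm z)\<^sup>2 \<le> C" using C(2) power_mono[of "norm z" "2 * M" 2] by simp
    have "w \<bullet> e \<le> speed" using norm_cauchy_schwarz[of w e] e w by simp
    then have "(L' - L) * (w \<bullet> e) \<le> (L' - L) * speed" using L'L by (rule mult_left_mono)
    then have "z \<bullet> e \<le> 0" using st(6) by (simp add: z_def inner_diff_left mult.commute)
    then have "norm E * (e \<bullet> z) \<le> 0" by (simp add: inner_commute mult_nonneg_nonpos)
    then have "E \<bullet> z \<le> 0" by (subst Ee) simp
    moreover have "(norm (E + z))\<^sup>2 = (norm E)\<^sup>2 + 2 * (E \<bullet> z) + (norm z)\<^sup>2"
      by (simp add: power2_norm_eq_inner inner_add_left inner_add_right inner_commute[of z E])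
    ultimately have "(norm (E + z))\<^sup>2 \<le> (real n + 1) * C + C" using IH(4) z2 by (simp add: E_def)
    also have "\<dots> = (real (Suc n) + 1) * C" by (simp add: algebra_simps)
    finally have "(norm (L' *\<^sub>R w - V (x + d)))\<^sup>2 \<le> (real (Suc n) + 1) * C" unfolding E' .
    moreover have "real (Suc n) * (1 - 2 * r) \<le> L'" using IH(3) st(3) by (simp add: algebra_simps)
    ultimately show ?case using st by blast
  qed
  with C(3) show ?thesis by blast
qed

text \<open>An error of order \<open>sqrt n\<close> against a length of order at least \<open>n\<close> vanishes in the limit. The ends of
  the trajectory differ from the lattice displacement by at most \<open>2 * r\<close>.\<close>

theorem cball_speed_subset: "cball 0 speed \<subseteq> admissible_rotation_set K"
proof
  fix w :: "real ^ 'm"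
  assume "w \<in> cball 0 speed"
  then have w: "norm w \<le> speed" by simp
  obtain C where C: "0 < C" and reach: "\<And>n. \<exists>s x a L. reaches s x a L \<and> a \<in> signed_axes \<and> 
     real n * (1 - 2 * r) \<le> L \<and> (norm (L *\<^sub>R w - V x))\<^sup>2 \<le> (real n + 1) * C"
    using reaches_tracking[OF w] by blast
  define d where "d = 1 - 2 * r"
  have d: "0 < d" using r_small r_pos by (simp add: d_def)
  have "\<exists>s k p. admissible K s k \<and> piece_of_type K s k p \<and> real n * d \<le> piece_length s p \<and>
      norm (piece_length s p *\<^sub>R w - (p s - p 0)) \<le> sqrt ((real n + 1) * C) + 1" for n
  proof -
    obtain s x a L where *: "reaches s x a L" "real n * d \<le> L" "(norm (L *\<^sub>R w - V x))\<^sup>2 \<le> (real n + 1) * C"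
      using reach[of n] by (auto simp: d_def)
    obtain k where k: "admissible K s k" "0 < s" "k s = x" "shortest_length s k = L"
      using *(1) by (auto simp: reaches_def)
    obtain p where p: "shortest_path K s k p" "piece_length s p = shortest_length s k"
      by (rule shortest_length)
    have "trajectory_piece K s k p" by (rule shortest_path_is_trajectory[OF K k(1,2) p(1)])
    then have "piece_of_type K s k p" unfolding piece_of_type_def by (intro exI[of _ 0]) simp
    moreover have "norm (L *\<^sub>R w - (p s - p 0)) \<le> sqrt ((real n + 1) * C) + 1"
    proof -
      have "norm ((p s - p 0) - V (k s - k 0)) \<le> 2 * r"
        using p(1) by (intro lift_diff) (auto simp: shortest_path_def)
      then have "norm (V x - (p s - p 0)) \<le> 1"
        using k r_small r_pos by (simp add: norm_minus_commute admissible_def)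
      moreover have "norm (L *\<^sub>R w - V x) \<le> sqrt ((real n + 1) * C)" using *(3) by (rule real_le_rsqrt)
      ultimately show ?thesis by (rule norm_diff_triangle_le[rotated])
    qed
    ultimately show ?thesis using k p *(2) by metis
  qed
  then obtain s k p where skp: "\<And>n. admissible K (s n) (k n)" "\<And>n. piece_of_type K (s n) (k n) (p n)"
    "\<And>n. real n * d \<le> piece_length (s n) (p n)"
    "\<And>n. norm (piece_length (s n) (p n) *\<^sub>R w - (p n (s n) - p n 0)) \<le> sqrt ((real n + 1) * C) + 1"
    by metis
  define t where "t n = piece_length (s n) (p n)" for n
  have "filterlim (\<lambda>n. real n * d) at_top sequentially" using d by real_asymp
  then have t_top: "filterlim t at_top sequentially"
    by (rule filterlim_at_top_mono) (simp add: t_def skp(3))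
  have lim: "(\<lambda>n. (p n (s n) - p n 0) /\<^sub>R t n) \<longlonglongrightarrow> w"
  proof (rule LIM_zero_cancel, rule Lim_null_comparison)
    show "\<forall>\<^sub>F n in sequentially. norm ((p n (s n) - p n 0) /\<^sub>R t n - w) \<le> (sqrt ((real n + 1) * C) + 1) / (real n * d)"
      using eventually_gt_at_top[of 0]
    proof eventually_elim
      case (elim n)
      then have nd: "0 < real n * d" using d by simp
      then have t0: "0 < t n" using skp(3)[of n] by (simp add: t_def)
      have "(p n (s n) - p n 0) /\<^sub>R t n - w = - ((t n *\<^sub>R w - (p n (s n) - p n 0)) /\<^sub>R t n)"
        using t0 by (simp add: scaleR_diff_right)
      then have "norm ((p n (s n) - p n 0) /\<^sub>R t n - w) = norm (t n *\<^sub>R w - (p n (s n) - p n 0)) / t n"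
        using t0 by (simp add: divide_inverse mult.commute)
      also have "\<dots> \<le> (sqrt ((real n + 1) * C) + 1) / (real n * d)"
        using skp(3)[of n] skp(4)[of n] nd C by (intro frac_le) (auto simp: t_def)
      finally show ?case .
    qed
    show "(\<lambda>n. (sqrt ((real n + 1) * C) + 1) / (real n * d)) \<longlonglongrightarrow> 0" using C d by real_asymp
  qed
  have "\<forall>n. \<exists>s' k' p'. admissible K s' k' \<and> piece_of_type K s' k' p' \<and>
      p' 0 = p n 0 \<and> p' s' = p n (s n) \<and> piece_length s' p' = t n"
  proof
    fix n
    show "\<exists>s' k' p'. admissible K s' k' \<and> piece_of_type K s' k' p' \<and>
      p' 0 = p n 0 \<and> p' s' = p n (s n) \<and> piece_length s' p' = t n"
      using skp(1,2)[of n] by (intro exI[of _ "s n"] exI[of _ "k n"] exI[of _ "p n"]) (simp add: t_def)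
  qed
  then show "w \<in> admissible_rotation_set K" unfolding admissible_rotation_set_def
    using t_top lim by (intro CollectI exI[of _ "\<lambda>n. p n 0"] exI[of _ "\<lambda>n. p n (s n)"] exI[of _ t] conjI)
qed

end

theorem theorem4p13:
  fixes K :: "(real ^ 'm) set" and c :: "real ^ 'm" and r :: real
  assumes "CARD('m) \<ge> 2"
    and "torus_obstacle K"
    and "K \<subseteq> cball c r"
    and "r < sqrt 2 / 4"
    and "N_defined r"
  shows "cball 0 ((real (N_of r) - 1) / (real (N_of r) + 1) * cos (2 * eta r))
           \<subseteq> admissible_rotation_set K"
proof -
  have r: "0 < r"
  proof -
    have "interior K \<noteq> {}" using assms(2) by (simp add: torus_obstacle_def)
    then have "interior (cball c r) \<noteq> {}" using interior_mono[OF assms(3)] by blast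
    then show ?thesis by (metis interior_cball ball_eq_empty not_le)
  qed
  note N = N_of_works[OF r assms(4,5)]
  interpret small_obstacle r "N_of r" "TYPE('m)" K c
  proof
    show "49 * r\<^sup>2 * ((real (N_of r))\<^sup>2 - 1) \<le> 1"
      using radius_bound[OF r assms(4) N] N(1) by (simp add: of_nat_diff)
  qed (use r N assms gram_short_vectors[OF r assms(4) N] in auto)
  have "speed * cos (2 * eta r) \<le> speed * 1" by (intro mult_left_mono speed_nonneg) simp
  then have "cball 0 (speed * cos (2 * eta r)) \<subseteq> (cball 0 speed :: (real ^ 'm) set)"
    by (intro subset_cball) simp
  then show ?thesis using cball_speed_subset by (simp add: speed_def)
qed

end
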